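(* Let $m\geq 1$ and $n\geq 1$ be integers and let $R\cong S\times T$ with $S=\prod_{i=1}^{m}R_{i}$ and $T=\prod_{j=1}^{n}\mathbb{F}_{j}$, where for every $1\leq i\leq m$, $R_{i}$ is a local Artinian principal ideal ring that is not a field, and $\mathbb{F}_{j}$ is a field for every $1\leq j\leq n$. Put $n_{i}=|I(R_{i})|$ for $1\leq i\leq m$. Then: 1) If $m=1$, then $sdim(In(R))=(n_{1}+2)2^{n}-2n-n_{1}-2$. 2) If $m\geq 2$, then $sdim(In(R))=\left(\prod_{i=1}^{m}(n_{i}+2)\right)2^{n}-\left(\sum_{i=1}^{m}n_{i}\right)-2n-m-1$.
   Context: All rings are commutative with identity. $I(R)$ denotes the set of non-trivial ideals of $R$ (ideals different from $0$ and $R$). The inclusion ideal graph $In(R)$ is the simple graph with vertex set $I(R)$, two distinct vertices being adjacent if and only if one of them is properly contained in the other. A local Artinian principal ideal ring has only finitely many ideals, and they are totally ordered by inclusion. For a graph $G$ with distance $d$, two vertices $u,v$ are strongly resolved by a vertex $w$ if $d(w,u)=d(w,v)+d(v,u)$ or $d(w,v)=d(w,u)+d(u,v)$. A set $W\subseteq V(G)$ is a strong resolving set if every two distinct vertices of $G$ are strongly resolved by some vertex of $W$. The strong metric dimension $sdim(G)$ is the minimum cardinality of a strong resolving set. *)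

theory Defs
  imports
    "HOL-Algebra.Chinese_Remainder"
    "Graph_Theory.Pair_Digraph"
    "Graph_Theory.Shortest_Path"
begin

section \<open>Rings\<close>

locale local_cring = cring +
  assumes unique_maximalideal: "\<exists>!M. maximalideal M R"

locale artinian_cring = cring +
  assumes descending_chain:
    "\<lbrakk> \<And>k::nat. ideal (C k) R; \<And>k. C (Suc k) \<subseteq> C k \<rbrakk> \<Longrightarrow> \<exists>N. \<forall>k\<ge>N. C k = C N"

locale principal_ideal_cring = cring +
  assumes all_principal: "ideal I R \<Longrightarrow> principalideal I R"

locale local_artinian_principal_ring = local_cring + artinian_cring + principal_ideal_cring

definition nontrivial_ideals :: "('a, 'b) ring_scheme \<Rightarrow> 'a set set" where
  "nontrivial_ideals R = {I. ideal I R \<and> I \<noteq> {\<zero>\<^bsub>R\<^esub>} \<and> I \<noteq> carrier R}"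

section \<open>The inclusion ideal graph\<close>

text \<open>As usual in the library, a simple graph is a symmetric loop-free digraph: every
  edge is represented by its two orientations.\<close>

definition inclusion_ideal_graph :: "('a, 'b) ring_scheme \<Rightarrow> 'a set pair_pre_digraph" where
  "inclusion_ideal_graph R =
     \<lparr> pverts = nontrivial_ideals R,
       parcs = {(I, J). I \<in> nontrivial_ideals R \<and> J \<in> nontrivial_ideals R \<and> (I \<subset> J \<or> J \<subset> I)} \<rparr>"

lemma pair_bidirected_inclusion_ideal_graph:
  "pair_bidirected_digraph (inclusion_ideal_graph R)"
  by unfold_locales
     (auto simp: inclusion_ideal_graph_def symmetric_def arcs_ends_def arc_to_ends_def sym_def)

section \<open>Strong metric dimension\<close>

text \<open>The distance is the least number of arcs of a walk, and \<open>\<infinity>\<close> if there is none.\<close>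

definition graph_dist :: "('a, 'b) pre_digraph \<Rightarrow> 'a \<Rightarrow> 'a \<Rightarrow> ereal" where
  "graph_dist G u v = wf_digraph.\<mu> G (\<lambda>_. 1) u v"

definition strongly_resolves :: "('a, 'b) pre_digraph \<Rightarrow> 'a \<Rightarrow> 'a \<Rightarrow> 'a \<Rightarrow> bool" where
  "strongly_resolves G w u v \<longleftrightarrow>
     graph_dist G w u = graph_dist G w v + graph_dist G v u \<or>
     graph_dist G w v = graph_dist G w u + graph_dist G u v"

definition strong_resolving_set :: "('a, 'b) pre_digraph \<Rightarrow> 'a set \<Rightarrow> bool" where
  "strong_resolving_set G W \<longleftrightarrow>
     W \<subseteq> verts G \<and>
     (\<forall>u\<in>verts G. \<forall>v\<in>verts G. u \<noteq> v \<longrightarrow> (\<exists>w\<in>W. strongly_resolves G w u v))"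

text \<open>Finiteness of \<open>W\<close> is required because \<^const>\<open>card\<close> is 0 on infinite sets; the value is
  unspecified if there is no finite strong resolving set.\<close>

definition sdim :: "('a, 'b) pre_digraph \<Rightarrow> nat" where
  "sdim G = (LEAST k. \<exists>W. finite W \<and> strong_resolving_set G W \<and> card W = k)"

end

(* The ideals of a local Artinian principal ideal ring form a finite chain, so the ideals of R form a
   product of chains, i.e. the lattice of downsets of a disjoint union E of chains (with h elements in
   all). In the graph of nontrivial downsets, comparable vertices are at distance 1, complementary
   ones at distance 3, all others at distance 2. A set W of vertices is strongly resolving iff no two
   vertices outside W are mutually maximally distant, which means: any two of them are not
   complementary, and are comparable, unless one of them has a complement in the lattice and they are
   disjoint or cover E. The largest such family N has h - 1 + n members. It is attained by a maximal
   chain that starts in an atom and ends in the coatom of the same non-field block, together with the n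
   one-element field blocks. For the upper bound, add to N the h - n singletons of E that lie in
   non-field blocks; at most two of them are, up to complement, in N already, since
   uncomplemented members of N form a chain. Up to complements the result is a laminar family
   of nonempty subsets of a set with h - 1 elements, so |N| + (h - n) - 2 <= 2(h - 1) - 1. *)

theory Submission
  imports Defs "HOL-Algebra.Ring_Divisibility"
begin

section \<open>Laminar families\<close>

definition laminar :: "'a set set \<Rightarrow> bool" where
  "laminar F \<longleftrightarrow> (\<forall>A\<in>F. \<forall>B\<in>F. A \<subseteq> B \<or> B \<subseteq> A \<or> A \<inter> B = {})"

lemma laminar_cases:
  assumes "laminar F" "A \<in> F" "B \<in> F"
  shows "A \<subseteq> B \<or> B \<subseteq> A \<or> A \<inter> B = {}"
  using assms unfolding laminar_def by simp

text \<open>\<open>insert x A\<close> and \<open>insert x B\<close> share \<open>x\<close>, so they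
  are nested, say \<open>A\<close> \<subseteq> \<open>B\<close>. Then \<open>insert x A\<close>
  meets \<open>B\<close> without being contained in it, which forces \<open>B\<close> \<subseteq>
  \<open>A\<close>. So deleting a point from a laminar family merges at most one pair of nonempty
  sets.\<close>

lemma laminar_eq_of_insert:
  assumes F: "laminar F" "A \<in> F" "insert x A \<in> F" "B \<in> F" "insert x B \<in> F"
    and ne: "A \<noteq> {}" "B \<noteq> {}" "x \<notin> A" "x \<notin> B"
  shows "A = B"
proof -
  have "A \<subseteq> B \<or> B \<subseteq> A"
    using laminar_cases[OF F(1,3,5)] ne by auto
  then show ?thesis
  proof
    assume "A \<subseteq> B"
    then show ?thesis using laminar_cases[OF F(1,3,4)] ne by auto
  next
    assume "B \<subseteq> A"
    then show ?thesis using laminar_cases[OF F(1,5,2)] ne by auto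
  qed
qed

text \<open>Induction on the ground set: deleting a point \<open>x\<close> from all members keeps
  the family laminar and costs at most two of them, \<open>{x}\<close> itself and one half of a
  single merging pair.\<close>

lemma card_laminar_le:
  assumes "finite X" "laminar F" "F \<subseteq> Pow X - {{}}"
  shows "card F \<le> 2 * card X - 1"
  using assms
proof (induction X arbitrary: F rule: finite_induct)
  case empty
  then show ?case by auto
next
  case (insert x X)
  have finF: "finite F"
    using insert.prems(2) insert.hyps(1) by (meson finite_Diff finite_Pow_iff finite_insert finite_subset)
  \<comment> \<open>\<open>P\<close> holds the smaller halves of the pairs that merge when
    \<open>x\<close> is deleted; \<open>F'\<close> drops the larger halves and \<open>{x}\<close>,
    which would become empty.\<close>
  define P where "P = {A \<in> F. A \<noteq> {} \<and> x \<notin> A \<and> insert x A \<in> F}"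
  define F' where "F' = F - insert x ` P - {{x}}"
  define G where "G = (\<lambda>A. A - {x}) ` F'"
  have "\<exists>a. P \<subseteq> {a}"
  proof (cases "P = {}")
    case False
    then obtain a where a: "a \<in> P" by auto
    have "b = a" if "b \<in> P" for b
      using laminar_eq_of_insert[OF insert.prems(1), of b x a] a that unfolding P_def by blast
    then show ?thesis by blast
  qed auto
  then obtain a where "P \<subseteq> {a}" by blast
  then have "insert x ` P \<subseteq> {insert x a}" by blast
  then have cP: "card (insert x ` P) \<le> 1"
    using card_mono[of "{insert x a}"] by fastforce
  have inj: "inj_on (\<lambda>A. A - {x}) F'"
  proof (rule inj_onI)
    fix A B assume AB: "A \<in> F'" "B \<in> F'" "A - {x} = B - {x}"
    show "A = B"
    proof (rule ccontr)
      assume ne: "A \<noteq> B"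
      have *: "x \<notin> C \<Longrightarrow> C \<in> F' \<Longrightarrow> insert x C \<notin> F'" for C
        using insert.prems(2) unfolding F'_def P_def by auto
      from ne AB(3) consider "x \<in> A" "x \<notin> B" | "x \<notin> A" "x \<in> B" by blast
      then show False
      proof cases
        case 1
        then have "A = insert x B" using AB(3) by blast
        then show False using * 1 AB by blast
      next
        case 2
        then have "B = insert x A" using AB(3) by blast
        then show False using * 2 AB by blast
      qed
    qed
  qed
  have lamG: "laminar G"
  proof -
    have "A - {x} \<subseteq> B - {x} \<or> B - {x} \<subseteq> A - {x} \<or> (A - {x}) \<inter> (B - {x}) = {}"
      if "A \<in> F" "B \<in> F" for A B
      using insert.prems(1) that unfolding laminar_def by blast
    then show ?thesis unfolding laminar_def G_def F'_def by simp
  qed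
  have subG: "G \<subseteq> Pow X - {{}}"
    using insert.prems(2) unfolding G_def F'_def by auto
  have G: "card G \<le> 2 * card X - 1" by (rule insert.IH[OF lamG subG])
  have cF': "card F' = card G"
    unfolding G_def by (rule card_image[OF inj, symmetric])
  have "F \<subseteq> F' \<union> insert x ` P \<union> {{x}}" unfolding F'_def by blast
  then have "card F \<le> card (F' \<union> insert x ` P \<union> {{x}})"
    using finF unfolding F'_def P_def by (intro card_mono) auto
  also have "\<dots> \<le> card F' + card (insert x ` P) + 1"
    using card_Un_le[of "F' \<union> insert x ` P" "{{x}}"] card_Un_le[of F' "insert x ` P"] by simp
  finally have "card F \<le> card G + 2" using cP cF' by simp
  \<comment> \<open>For empty \<open>X\<close> the truncated bound 2 * 0 - 1 is 0 rather than -1, so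
    the induction hypothesis would only give 2.\<close>
  moreover have "card F \<le> 1" if "X = {}"
  proof -
    have "F \<subseteq> {{x}}" using insert.prems(2) that by auto
    then show ?thesis using card_mono[of "{{x}}" F] by simp
  qed
  moreover have "card X \<ge> 1" if "X \<noteq> {}"
    using that insert.hyps(1) by (simp add: Suc_le_eq card_gt_0_iff)
  ultimately show ?case using insert.hyps G by (cases "X = {}") auto
qed

section \<open>Products of chains as lattices of downsets\<close>

text \<open>Block i is a chain with \<open>hs ! i\<close> cells; cells of different blocks are
  incomparable. A downset is determined by how many cells it takes from the bottom of each block, so
  downsets encode tuples bounded by \<open>hs\<close>.\<close>

definition cells :: "nat list \<Rightarrow> (nat \<times> nat) set" where
  "cells hs = (SIGMA i:{..<length hs}. {..<hs ! i})"

definition downsets :: "nat list \<Rightarrow> (nat \<times> nat) set set" where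
  "downsets hs = {D. D \<subseteq> cells hs \<and> (\<forall>i s t. (i, t) \<in> D \<longrightarrow> s \<le> t \<longrightarrow> (i, s) \<in> D)}"

lemma finite_cells: "finite (cells hs)"
  unfolding cells_def by auto

lemma card_cells: "card (cells hs) = sum_list hs"
  unfolding cells_def by (simp add: sum_list_sum_nth lessThan_atLeast0)

text \<open>Each block stands for the ideal chain of one factor, its height being one less than the
  number of ideals: 1 for a field, at least 2 otherwise. Block 0 belongs to a factor that is not a
  field.\<close>

locale chain_product =
  fixes hs :: "nat list"
  assumes two_le_length: "2 \<le> length hs"
    and pos: "i < length hs \<Longrightarrow> 0 < hs ! i"
    and two_le_hd: "2 \<le> hs ! 0"
begin

abbreviation E where "E \<equiv> cells hs"

definition V :: "(nat \<times> nat) set set" where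
  "V = downsets hs - {{}, E}"

definition adj :: "(nat \<times> nat) set \<Rightarrow> (nat \<times> nat) set \<Rightarrow> bool" where
  "adj u v \<longleftrightarrow> u \<subset> v \<or> v \<subset> u"

text \<open>The closed form of the graph distance, confirmed for the ideal graph in
  \<open>graph_dist_eq\<close>.\<close>

definition d :: "(nat \<times> nat) set \<Rightarrow> (nat \<times> nat) set \<Rightarrow> nat" where
  "d u v = (if u = v then 0 else if adj u v then 1 else if v = E - u then 3 else 2)"

text \<open>For distinct vertices this negates being mutually maximally distant. The last
  alternative covers pairs at distance 2 where the complement of one vertex is adjacent to the
  other.\<close>

definition compat :: "(nat \<times> nat) set \<Rightarrow> (nat \<times> nat) set \<Rightarrow> bool" where
  "compat u v \<longleftrightarrow> v \<noteq> E - u \<and>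
     (u \<subseteq> v \<or> v \<subseteq> u \<or> ((E - u \<in> V \<or> E - v \<in> V) \<and> (u \<inter> v = {} \<or> u \<union> v = E)))"

definition resolves where
  "resolves w u v \<longleftrightarrow> d w u = d w v + d v u \<or> d w v = d w u + d u v"

lemma mem_E [simp]: "(i, t) \<in> E \<longleftrightarrow> i < length hs \<and> t < hs ! i"
  unfolding cells_def by auto

lemma VD: "u \<in> V \<Longrightarrow> u \<subseteq> E" "u \<in> V \<Longrightarrow> u \<noteq> {}" "u \<in> V \<Longrightarrow> u \<noteq> E"
  "u \<in> V \<Longrightarrow> (i, t) \<in> u \<Longrightarrow> s \<le> t \<Longrightarrow> (i, s) \<in> u"
  unfolding V_def downsets_def by blast+

lemma VI: "u \<subseteq> E \<Longrightarrow> u \<noteq> {} \<Longrightarrow> u \<noteq> E \<Longrightarrow> (\<And>i s t. (i, t) \<in> u \<Longrightarrow> s \<le> t \<Longrightarrow> (i, s) \<in> u) \<Longrightarrow> u \<in> V"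
  unfolding V_def downsets_def by blast

lemma finite_V: "finite V"
  by (rule finite_subset[of _ "Pow E"]) (auto simp: V_def downsets_def finite_cells)

lemma Int_V: "u \<in> V \<Longrightarrow> v \<in> V \<Longrightarrow> u \<inter> v \<noteq> {} \<Longrightarrow> u \<inter> v \<in> V"
  using VD[of u] VD[of v] by (intro VI) (blast, blast, blast, auto)

lemma Un_V: "u \<in> V \<Longrightarrow> v \<in> V \<Longrightarrow> u \<union> v \<noteq> E \<Longrightarrow> u \<union> v \<in> V"
  by (rule VI) (auto dest: VD)

lemma adj_commute: "adj u v \<longleftrightarrow> adj v u"
  unfolding adj_def by blast

lemma compl_eq_commute: "u \<in> V \<Longrightarrow> v \<in> V \<Longrightarrow> v = E - u \<longleftrightarrow> u = E - v"
  using VD(1)[of u] VD(1)[of v] by blast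

lemma d_commute: "u \<in> V \<Longrightarrow> v \<in> V \<Longrightarrow> d u v = d v u"
  unfolding d_def using adj_commute compl_eq_commute by auto

lemma d_eq_0: "d u v = 0 \<longleftrightarrow> u = v"
  unfolding d_def by auto

lemma d_le_3: "d u v \<le> 3"
  unfolding d_def by auto

lemma not_adj_compl: "u \<in> V \<Longrightarrow> \<not> adj u (E - u)"
  unfolding adj_def using VD[of u] by blast

lemma d_eq_3: "u \<in> V \<Longrightarrow> d u v = 3 \<longleftrightarrow> v = E - u"
  unfolding d_def using not_adj_compl[of u] VD(2)[of u] VD(3)[of u] by auto

lemma d_eq_1: "u \<in> V \<Longrightarrow> d u v = 1 \<longleftrightarrow> adj u v"
  unfolding d_def adj_def by auto

text \<open>A common neighbour of two complementary sets cannot contain both (it would be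
  \<open>E\<close>), lie inside both (it would be empty) or lie between them (they would be
  nested).\<close>

lemma adj_adj_not_compl: 
  assumes "u \<in> V" "v \<in> V" "w \<in> V" "adj u v" "adj v w"
  shows "w \<noteq> E - u"
proof
  assume w: "w = E - u"
  consider "u \<subset> v" "v \<subset> w" | "u \<subset> v" "w \<subset> v" | "v \<subset> u" "v \<subset> w" | "v \<subset> u" "w \<subset> v"
    using assms unfolding adj_def by blast
  then show False
    using VD[OF assms(1)] VD[OF assms(2)] VD[OF assms(3)] w by cases blast+
qed

text \<open>As all values are at most 3, only two steps of length 1 could violate the inequality,
  and complementary vertices have no common neighbour.\<close>

lemma d_triangle:
  assumes "u \<in> V" "v \<in> V" "w \<in> V"
  shows "d u w \<le> d u v + d v w"
proof (cases "d u v = 0 \<or> d v w = 0")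
  case True
  then show ?thesis using d_eq_0 by auto
next
  case False
  show ?thesis
  proof (cases "d u v = 1 \<and> d v w = 1")
    case True
    then have "d u w \<noteq> 3"
      using adj_adj_not_compl[OF assms] d_eq_1 d_eq_3 assms by blast
    then show ?thesis using True d_le_3[of u w] by simp
  next
    case 2: False
    then show ?thesis using False d_le_3[of u w] by linarith
  qed
qed

section \<open>Mutually maximally distant pairs\<close>

lemma ex_other_index: "\<exists>j<length hs. j \<noteq> i"
  using two_le_length by (cases "i = 0") (auto intro: exI[of _ 1] exI[of _ 0])

text \<open>Hence comparable vertices are never mutually maximally distant.\<close>

lemma psubset_imp_extension:
  assumes u: "u \<in> V" and v: "v \<in> V" and uv: "u \<subset> v"
  shows "\<exists>w\<in>V. (adj w v \<and> \<not> adj w u \<and> w \<noteq> u) \<or> (adj w u \<and> \<not> adj w v \<and> w \<noteq> v)"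
proof -
  \<comment> \<open>If \<open>u\<close> has a cell outside block i, the part of \<open>v\<close>
    inside block i lies strictly below \<open>v\<close> and is incomparable with \<open>u\<close>:
    it contains (i, a) and misses (j, b).\<close>
  have A: ?thesis if ia: "(i, a) \<in> v - u" and jb: "(j, b) \<in> u" "j \<noteq> i" for i a j b
  proof -
    let ?w = "{p \<in> v. fst p = i}"
    have jw: "(j, b) \<in> v" "(j, b) \<notin> ?w" using jb uv by auto
    have iw: "(i, a) \<in> ?w" using ia by simp
    have "?w \<in> V"
    proof (rule VI)
      show "?w \<subseteq> E" using VD(1)[OF v] by blast
      show "?w \<noteq> {}" using iw by blast
      show "?w \<noteq> E" using jw VD(1)[OF v] by blast
      show "(k, s) \<in> ?w" if "(k, t) \<in> ?w" "s \<le> t" for k s t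
        using VD(4)[OF v, of k t s] that by auto
    qed
    moreover have "?w \<subset> v" using jw by blast
    moreover have "\<not> ?w \<subseteq> u" "\<not> u \<subseteq> ?w" using ia iw jb jw by blast+
    ultimately show ?thesis unfolding adj_def by blast
  qed
  \<comment> \<open>Dually, if \<open>v\<close> misses a cell outside block i, adding all other
    blocks to \<open>u\<close> gives a set strictly above \<open>u\<close>. It has (j, b) but not
    (i, a), so it is incomparable with \<open>v\<close>.\<close>
  have B: ?thesis if ia: "(i, a) \<in> v - u" and jb: "(j, b) \<in> E - v" "j \<noteq> i" for i a j b
  proof -
    let ?w = "u \<union> {p \<in> E. fst p \<noteq> i}"
    have jw: "(j, b) \<notin> u" "(j, b) \<in> ?w" using jb uv by auto
    have iw: "(i, a) \<notin> ?w" using ia by simp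
    have "?w \<in> V"
    proof (rule VI)
      show "?w \<subseteq> E" using VD(1)[OF u] by blast
      show "?w \<noteq> {}" using jw by blast
      show "?w \<noteq> E" using iw ia VD(1)[OF v] by blast
      show "(k, s) \<in> ?w" if "(k, t) \<in> ?w" "s \<le> t" for k s t
        using VD(4)[OF u, of k t s] that by auto
    qed
    moreover have "u \<subset> ?w" using jw by blast
    moreover have "\<not> ?w \<subseteq> v" "\<not> v \<subseteq> ?w" using ia iw jb jw by blast+
    ultimately show ?thesis unfolding adj_def by blast
  qed
  \<comment> \<open>If both constructions fail for i, then \<open>u\<close> lies in block i while
    \<open>v\<close> contains the bottom cell of another block j; the first construction then works
    with j in place of i.\<close>
  show ?thesis
  proof (rule ccontr)
    assume no: "\<not> ?thesis"
    obtain i a where ia: "(i, a) \<in> v - u" using uv by auto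
    obtain k b where kb: "(k, b) \<in> u" using VD(2)[OF u] by auto
    have k: "k = i" using A[OF ia kb] no by blast
    obtain j where j: "j < length hs" "j \<noteq> i" using ex_other_index by blast
    have jE: "(j, 0) \<in> E" using j pos by simp
    have "(j, 0) \<in> v" using B[OF ia _ j(2), of 0] jE no by blast
    moreover have "(j, 0) \<notin> u" using A[OF ia _ j(2), of 0] no by blast
    ultimately have "(j, 0) \<in> v - u" by blast
    from A[OF this kb] k j no show False by blast
  qed
qed

text \<open>A shortest path from \<open>u\<close> to \<open>v\<close> can be prolonged to
  \<open>w\<close>, so \<open>v\<close> is not maximally distant from \<open>u\<close>.\<close>

definition extends where
  "extends w u v \<longleftrightarrow> w \<in> V \<and> w \<noteq> v \<and> d w u = d w v + d v u"

text \<open>The complement of \<open>u\<close> is at distance 3 from \<open>u\<close>, and the last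
  hypothesis makes it comparable with \<open>v\<close>; the distances are 3 = 1 + 2.\<close>

lemma compl_extends:
  assumes u: "u \<in> V" and v: "v \<in> V" and c: "E - u \<in> V"
    and na: "\<not> adj u v" "u \<noteq> v" "v \<noteq> E - u" and dis: "u \<inter> v = {} \<or> u \<union> v = E"
  shows "extends (E - u) u v"
proof -
  have "adj (E - u) v"
    using dis na VD(1)[OF u] VD(1)[OF v] unfolding adj_def by blast
  moreover have "d (E - u) u = 3"
    using d_eq_3[OF c, of u] VD(1)[OF u] by blast
  moreover have "d v u = 2"
    using na compl_eq_commute[OF u v] adj_commute unfolding d_def by auto
  ultimately show ?thesis
    unfolding extends_def using c na(3) d_eq_1[OF c, of v] by force
qed

text \<open>By the triangle inequality, \<open>w\<close> lies at distance exactly 2 = 1 + 1 from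
  \<open>u\<close>.\<close>

lemma adj_extends:
  assumes "u \<in> V" "v \<in> V" "w \<in> V" "adj u v" "adj w v" "\<not> adj w u" "w \<noteq> u"
  shows "extends w u v"
proof -
  have "d w v = 1" "d v u = 1"
    using assms d_eq_1 adj_commute by auto
  moreover have "d w u \<noteq> 0" "d w u \<noteq> 1" using assms d_eq_0 d_eq_1 by auto
  moreover have "d w u \<le> d w v + d v u" using d_triangle assms by blast
  ultimately show ?thesis using assms unfolding extends_def adj_def by auto
qed

lemma compat_commute: "u \<in> V \<Longrightarrow> v \<in> V \<Longrightarrow> compat u v \<longleftrightarrow> compat v u"
  unfolding compat_def using compl_eq_commute by (metis inf_commute sup_commute)

lemma compat_imp_extends:
  assumes u: "u \<in> V" and v: "v \<in> V" and "compat u v" "u \<noteq> v"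
  shows "\<exists>w. extends w u v \<or> extends w v u"
proof (cases "adj u v")
  case True
  have "\<exists>w\<in>V. (adj w v \<and> \<not> adj w u \<and> w \<noteq> u) \<or> (adj w u \<and> \<not> adj w v \<and> w \<noteq> v)"
    using True psubset_imp_extension[OF u v] psubset_imp_extension[OF v u] unfolding adj_def by blast
  then show ?thesis
    using adj_extends u v True adj_commute by blast
next
  case False
  then have nc: "v \<noteq> E - u" "u \<noteq> E - v" "E - u \<in> V \<or> E - v \<in> V" "u \<inter> v = {} \<or> u \<union> v = E"
    using assms compl_eq_commute[OF u v] unfolding compat_def adj_def by blast+
  then have dis': "v \<inter> u = {} \<or> v \<union> u = E" by blast
  have na': "\<not> adj v u" "v \<noteq> u" using False adj_commute assms(4) by blast+
  show ?thesis
    using compl_extends[OF u v _ False assms(4) nc(1) nc(4)]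
      compl_extends[OF v u _ na' nc(2) dis'] nc(3) by blast
qed

text \<open>No shortest path between incompatible vertices can be prolonged. Complementary ones
  already have the maximal distance 3; at distance 2 a prolongation would have to reach 3, so
  \<open>w\<close> would be the complement of \<open>u\<close> and adjacent to \<open>v\<close>,
  which makes the pair compatible.\<close>

lemma incompat_resolves:
  assumes u: "u \<in> V" and v: "v \<in> V" and w: "w \<in> V" and nc: "\<not> compat u v"
    and eq: "d w u = d w v + d v u"
  shows "w = v"
proof (rule ccontr)
  assume ne: "w \<noteq> v"
  then have pos: "d w v \<ge> 1" using d_eq_0[of w v] by linarith
  show False
  proof (cases "v = E - u")
    case True
    then have "d v u = 3" using d_eq_3[OF v] compl_eq_commute[OF u v] by blast
    then show False using eq pos d_le_3[of w u] by linarith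
  next
    case False
    then have n: "\<not> (u \<subseteq> v \<or> v \<subseteq> u)" "\<not> ((E - u \<in> V \<or> E - v \<in> V) \<and> (u \<inter> v = {} \<or> u \<union> v = E))"
      using nc unfolding compat_def by auto
    then have "d v u = 2"
      using False compl_eq_commute[OF u v] unfolding d_def adj_def by auto
    then have "d w v = 1" "d w u = 3" using eq pos d_le_3[of w u] by linarith+
    then have 1: "adj w v" "u = E - w" using d_eq_1[OF w] d_eq_3[OF w] by auto
    then have "w = E - u" using compl_eq_commute[OF u w] by blast
    then show False using 1 n w VD(1)[OF u] VD(1)[OF v] unfolding adj_def by blast
  qed
qed

section \<open>Resolving sets and compatible families\<close>

definition resolving where
  "resolving W \<longleftrightarrow> W \<subseteq> V \<and> (\<forall>u\<in>V. \<forall>v\<in>V. u \<noteq> v \<longrightarrow> (\<exists>w\<in>W. resolves w u v))"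

text \<open>Only its own two members resolve an incompatible pair, so one of them must lie in
  \<open>W\<close>.\<close>

lemma resolving_imp_compat:
  assumes "resolving W" "u \<in> V - W" "v \<in> V - W" "u \<noteq> v"
  shows "compat u v"
proof (rule ccontr)
  assume nc: "\<not> compat u v"
  then have nc': "\<not> compat v u" using compat_commute assms by blast
  obtain w where w: "w \<in> W" "resolves w u v" "w \<in> V"
    using assms unfolding resolving_def by blast
  then have "w = u \<or> w = v"
    using incompat_resolves[of u v w] incompat_resolves[of v u w] nc nc' assms(2,3)
    unfolding resolves_def by blast
  then show False using w assms by blast
qed

lemma compat_imp_resolving:
  assumes W: "W \<subseteq> V" and c: "\<And>u v. u \<in> V - W \<Longrightarrow> v \<in> V - W \<Longrightarrow> u \<noteq> v \<Longrightarrow> compat u v"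
  shows "resolving W"
proof -
  have "\<exists>w\<in>W. resolves w u v" if "u \<in> V" "v \<in> V" "u \<noteq> v" for u v
    using that
  \<comment> \<open>Downward induction on the distance, which is at most 3: a pair outside
    \<open>W\<close> is replaced by a farther one, obtained by prolonging a shortest path.\<close>
  proof (induction "3 - d u v" arbitrary: u v rule: less_induct)
    case less
    note u = less.prems(1) and v = less.prems(2)
    \<comment> \<open>Whatever resolves the farther pair \<open>x\<close>, \<open>u\<close> also
      resolves \<open>u\<close>, \<open>v\<close>, because \<open>v\<close> lies on a shortest path
      between \<open>x\<close> and \<open>u\<close>.\<close>
    have step: "\<exists>w\<in>W. resolves w u v" if x: "extends x u v" and uv: "u \<in> V" "v \<in> V" "u \<noteq> v"
      and IH: "\<And>a b. 3 - d a b < 3 - d u v \<Longrightarrow> a \<in> V \<Longrightarrow> b \<in> V \<Longrightarrow> a \<noteq> b \<Longrightarrow> \<exists>w\<in>W. resolves w a b"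
      for x u v
    proof -
      have xV: "x \<in> V" and xd: "d x u = d x v + d v u" "x \<noteq> v" using x unfolding extends_def by auto
      have p: "d x v \<ge> 1" "d v u \<ge> 1" using xd(2) uv(3) d_eq_0[of x v] d_eq_0[of v u] by (auto simp: Suc_le_eq)
      have "3 - d x u < 3 - d u v"
        using xd p d_le_3[of x u] d_commute[OF uv(1,2)] by linarith
      moreover have "x \<noteq> u" using xd p d_eq_0[of x u] by linarith
      ultimately obtain w where w: "w \<in> W" "resolves w x u" using IH xV uv by blast
      then have wV: "w \<in> V" using W by blast
      have "d u x = d x u" "d u v = d v u" "d x v = d v x"
        using d_commute xV uv by blast+
      moreover have "d w v \<le> d w u + d u v" "d w x \<le> d w v + d v x" 
        "d w v \<le> d w x + d x v" "d w u \<le> d w v + d v u"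
        using d_triangle wV xV uv by blast+
      ultimately have "d w v = d w u + d u v \<or> d w u = d w v + d v u"
        using w(2) xd unfolding resolves_def by linarith
      then show ?thesis using w(1) unfolding resolves_def by blast
    qed
    have self: "resolves u u v" "resolves v u v"
      unfolding resolves_def by (simp_all add: d_def)
    show ?case
    proof (cases "u \<in> W \<or> v \<in> W")
      case True
      then show ?thesis using self by blast
    next
      case False
      then have "compat u v" using c less.prems by blast
      then obtain x where "extends x u v \<or> extends x v u"
        using compat_imp_extends less.prems by blast
      then consider "extends x u v" | "extends x v u" by blast
      then show ?thesis
      proof cases
        case 1
        then show ?thesis using step[OF 1] less by blast
      next
        case 2
        have "3 - d v u = 3 - d u v" using d_commute[OF u v] by simp
        then have "\<exists>w\<in>W. resolves w v u"
          using step[OF 2 v u] less.hyps less.prems(3) by simp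
        then show ?thesis unfolding resolves_def by blast
      qed
    qed
  qed
  then show ?thesis using W unfolding resolving_def by blast
qed

end

text \<open>From \<open>A\<close> to \<open>B\<close> one cell is added at a time, always the lowest
  missing cell of some block, so that every stage is a downset.\<close>

lemma ex_downset_chain:
  assumes "A \<in> downsets hs" "B \<in> downsets hs" "A \<subseteq> B"
  shows "\<exists>C \<subseteq> downsets hs. (\<forall>c\<in>C. A \<subseteq> c \<and> c \<subseteq> B) \<and> (\<forall>c\<in>C. \<forall>c'\<in>C. c \<subseteq> c' \<or> c' \<subseteq> c) \<and>
           card C = card (B - A) + 1"
  using assms
proof (induction "card (B - A)" arbitrary: A)
  case 0
  have "finite B" using 0(3) finite_subset[OF _ finite_cells] unfolding downsets_def by blast
  then have "A = B" using 0 by simp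
  then show ?case using 0 by (intro exI[of _ "{A}"]) auto
next
  case (Suc m)
  have fB: "finite B" using Suc(4) finite_subset[OF _ finite_cells] unfolding downsets_def by blast
  obtain i t where it: "(i, t) \<in> B - A" using Suc(2) by (metis card.empty ex_in_conv nat.distinct(1) surj_pair)
  define s where "s = (LEAST s. (i, s) \<in> B - A)"
  have s: "(i, s) \<in> B - A" unfolding s_def using LeastI[of "\<lambda>s. (i, s) \<in> B - A"] it by blast
  have s': "(i, r) \<notin> B - A" if "r < s" for r using not_less_Least that unfolding s_def by blast
  have sA: "(i, r) \<in> A" if "r < s" for r
    using s s'[OF that] that Suc(4) unfolding downsets_def by (auto dest: less_imp_le)
  have A': "insert (i, s) A \<in> downsets hs"
  proof -
    have "insert (i, s) A \<subseteq> cells hs" using Suc(3,4) s unfolding downsets_def by auto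
    moreover have "(j, r) \<in> insert (i, s) A" if "(j, q) \<in> insert (i, s) A" "r \<le> q" for j q r
    proof (cases "(j, q) = (i, s)")
      case True
      then show ?thesis using sA[of r] that(2) by (cases "r = s") simp_all
    next
      case False
      then show ?thesis using that Suc(3) unfolding downsets_def by blast
    qed
    ultimately show ?thesis unfolding downsets_def by blast
  qed
  have "B - A = insert (i, s) (B - insert (i, s) A)" using s by blast
  then have m: "m = card (B - insert (i, s) A)"
    using Suc(2) fB by (metis DiffD2 card_insert_disjoint finite_Diff insertI1 nat.inject)
  obtain C where C: "C \<subseteq> downsets hs" "\<forall>c\<in>C. insert (i, s) A \<subseteq> c \<and> c \<subseteq> B"
    "\<forall>c\<in>C. \<forall>c'\<in>C. c \<subseteq> c' \<or> c' \<subseteq> c" "card C = m + 1"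
    using Suc(1)[OF m A' Suc(4)] s Suc(5) m by auto
  have "A \<notin> C" using C(2) s by blast
  then have "card (insert A C) = Suc m + 1"
    using C(4) by (metis add.commute card_ge_0_finite card_insert_disjoint plus_1_eq_Suc zero_less_Suc)
  then show ?case
    using C Suc(2,3,5) by (intro exI[of _ "insert A C"]) auto
qed

section \<open>The largest compatible families\<close>

context chain_product
begin

text \<open>These are the field blocks; the single cell of such a block forms a vertex whose
  complement is a vertex too.\<close>

definition singles :: "nat set" where
  "singles = {i. i < length hs \<and> hs ! i = 1}"

lemma finite_singles: "finite singles"
  unfolding singles_def by simp

lemma ex_compat_family:
  "\<exists>N \<subseteq> V. card N = sum_list hs - 1 + card singles \<and> (\<forall>u\<in>N. \<forall>v\<in>N. u \<noteq> v \<longrightarrow> compat u v)"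
proof -
  define t where "t = hs ! 0 - 1"
  have l0: "0 < length hs" using two_le_length by linarith
  have t: "t \<ge> 1" "t < hs ! 0"
    using two_le_hd unfolding t_def by auto
  \<comment> \<open>An atom and a coatom of the same block, of height at least 2. All members of a
    chain between them contain (0, 0) and miss (0, t), so no two are complementary and none is the
    complement of a field cell.\<close>
  define A where "A = {(0::nat, 0::nat)}"
  define B where "B = E - {(0, t)}"
  have E0: "(0, 0) \<in> E" "(0, t) \<in> E" using l0 t by auto
  have A: "A \<in> downsets hs" using E0 unfolding A_def downsets_def by auto
  have "(i, r) \<in> B" if "(i, q) \<in> B" "r \<le> q" for i q r
    using that unfolding B_def t_def by auto
  then have B: "B \<in> downsets hs" unfolding downsets_def B_def by blast
  have AB: "A \<subseteq> B" using E0 t unfolding A_def B_def by auto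
  obtain C where C: "C \<subseteq> downsets hs" "\<And>c. c \<in> C \<Longrightarrow> A \<subseteq> c \<and> c \<subseteq> B"
    "\<And>c c'. c \<in> C \<Longrightarrow> c' \<in> C \<Longrightarrow> c \<subseteq> c' \<or> c' \<subseteq> c" "card C = card (B - A) + 1"
    using ex_downset_chain[OF A B AB] by metis
  \<comment> \<open>The two removed cells differ since \<open>t\<close> \<ge> 1, so with h cells in
    all the chain has (h - 2) + 1 members.\<close>
  have "B - A = E - {(0, 0), (0, t)}" unfolding A_def B_def by blast
  then have "card (B - A) = sum_list hs - 2"
    using E0 t finite_cells by (simp add: card_Diff_subset card_cells)
  moreover have "2 \<le> sum_list hs"
    using two_le_hd elem_le_sum_list[OF l0] by linarith
  ultimately have cC: "card C = sum_list hs - 1" using C(4) by linarith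
  then have finC: "finite C" using \<open>2 \<le> sum_list hs\<close> by (intro card_ge_0_finite) simp
  \<comment> \<open>A field cell has a complement in \<open>V\<close>, and a singleton is contained
    in or disjoint from any other set. Compatibility with the chain and among field cells thus only
    requires ruling out complementary pairs.\<close>
  define S where "S = (\<lambda>j. {(j::nat, 0::nat)}) ` singles"
  have cS: "card S = card singles"
    unfolding S_def by (intro card_image) (auto simp: inj_on_def)
  have s0: "0 \<notin> singles" using two_le_hd unfolding singles_def by simp
  have dis: "C \<inter> S = {}"
  proof -
    have "c \<notin> S" if "c \<in> C" for c using C(2)[OF that] s0 unfolding A_def S_def by auto
    then show ?thesis by blast
  qed
  have CV: "C \<subseteq> V"
  proof
    fix c assume c: "c \<in> C"
    have "c \<noteq> {}" "c \<noteq> E" using C(2)[OF c] E0(2) unfolding A_def B_def by blast+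
    then show "c \<in> V" using c C(1) unfolding V_def by blast
  qed
  have sE: "(j, 0) \<in> E" if "j \<in> singles" for j using that pos unfolding singles_def by simp
  have j0: "j \<noteq> 0" if "j \<in> singles" for j using s0 that by metis
  have SV: "{(j, 0)} \<in> V" if "j \<in> singles" for j
  proof (rule VI)
    show "{(j, 0)} \<subseteq> E" using sE[OF that] by simp
    show "{(j, 0)} \<noteq> E" using E0(1) j0[OF that] by (metis Pair_inject singletonD)
  qed auto
  have SV': "E - {(j, 0)} \<in> V" if "j \<in> singles" for j
  proof (rule VI)
    have "(0, 0) \<in> E - {(j, 0)}" using E0(1) j0[OF that] by simp
    then show "E - {(j, 0)} \<noteq> {}" by (metis empty_iff)
    show "E - {(j, 0)} \<noteq> E" using sE[OF that] by (metis DiffD2 singletonI)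
    show "(i, r) \<in> E - {(j, 0)}" if "(i, q) \<in> E - {(j, 0)}" "r \<le> q" for i q r
      using that \<open>j \<in> singles\<close> by (auto simp: singles_def)
  qed simp
  have CC: "compat c c'" if "c \<in> C" "c' \<in> C" for c c'
  proof -
    have "c' \<noteq> E - c" using C(2)[OF that(1)] C(2)[OF that(2)] unfolding A_def by blast
    then show ?thesis using C(3)[OF that] unfolding compat_def by blast
  qed
  have CS: "compat c {(j, 0)}" if "c \<in> C" "j \<in> singles" for c j
  proof -
    have "(0, t) \<in> E - c" using C(2)[OF that(1)] E0(2) unfolding B_def by blast
    then have "{(j, 0)} \<noteq> E - c" using j0[OF that(2)] by (metis Pair_inject singletonD)
    moreover have "{(j, 0)} \<subseteq> c \<or> c \<inter> {(j, 0)} = {}" by simp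
    ultimately show ?thesis using SV'[OF that(2)] unfolding compat_def by metis
  qed
  have SC: "compat {(j, 0)} c" if "c \<in> C" "j \<in> singles" for c j
    using CS[OF that] compat_commute[OF _ SV[OF that(2)]] CV that by blast
  have SS: "compat {(i, 0)} {(j, 0)}" if "i \<in> singles" "j \<in> singles" for i j
  proof -
    have "(0, 0) \<in> E - {(i, 0)}" using E0(1) j0[OF that(1)] by simp
    then have "{(j, 0)} \<noteq> E - {(i, 0)}" using j0[OF that(2)] by (metis Pair_inject singletonD)
    moreover have "{(i, 0)} \<subseteq> {(j, 0)} \<or> {(i, 0)} \<inter> {(j, 0)} = {}" by auto
    ultimately show ?thesis using SV'[OF that(1)] unfolding compat_def by metis
  qed
  have "card (C \<union> S) = sum_list hs - 1 + card singles"
    using card_Un_disjoint[OF finC _ dis] cC cS finite_singles unfolding S_def by simp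
  moreover have "C \<union> S \<subseteq> V" using CV SV unfolding S_def by blast
  moreover have "\<forall>u\<in>C \<union> S. \<forall>v\<in>C \<union> S. u \<noteq> v \<longrightarrow> compat u v"
    using CC CS SC SS unfolding S_def by blast
  ultimately show ?thesis by blast
qed

text \<open>A one-cell downset consists of the bottom cell of its block; its complement then has the
  second cell without the bottom one.\<close>

lemma big_cell_not_complemented:
  assumes "(i, t) \<in> E" "2 \<le> hs ! i" "{(i, t)} \<in> V"
  shows "E - {(i, t)} \<notin> V"
proof
  assume "E - {(i, t)} \<in> V"
  have t: "t = 0" using VD(4)[OF assms(3), of i t 0] by auto
  have "(i, 1) \<in> E - {(i, t)}" using assms t by auto
  then show False using VD(4)[OF \<open>E - {(i, t)} \<in> V\<close>, of i 1 0] t by auto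
qed

lemma card_big_cells: "card {e \<in> E. 2 \<le> hs ! fst e} + card singles = sum_list hs"
proof -
  let ?S = "(\<lambda>j. (j, 0::nat)) ` singles"
  have S: "?S \<subseteq> E" unfolding singles_def by auto
  have "{e \<in> E. 2 \<le> hs ! fst e} = E - ?S"
    using pos unfolding singles_def by force
  moreover have "card ?S = card singles"
    by (intro card_image) (auto simp: inj_on_def)
  moreover have "card (E - ?S) + card ?S = card E"
    using card_Un_disjoint[of "E - ?S" ?S] S finite_cells finite_singles
    by (simp add: Un_absorb2 Int_commute)
  ultimately show ?thesis by (simp add: card_cells)
qed

lemma three_le_card_E: "3 \<le> card E"
proof -
  have "{(0, 0), (0, 1), (1, 0)} \<subseteq> E" using two_le_length two_le_hd pos[of 1] by auto
  from card_mono[OF finite_cells this] show ?thesis by simp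
qed

lemma card_compat_family_le:
  assumes N: "N \<subseteq> V" and compat: "\<And>u v. u \<in> N \<Longrightarrow> v \<in> N \<Longrightarrow> u \<noteq> v \<Longrightarrow> compat u v"
  shows "card N \<le> sum_list hs - 1 + card singles"
proof -
  define p where "p = (0::nat, 0::nat)"
  have pE: "p \<in> E" using two_le_length two_le_hd unfolding p_def by auto
  \<comment> \<open>Of a set and its complement, \<open>rep\<close> selects the one that avoids
    \<open>p\<close>. This turns a family without crossing pairs into a laminar one on h - 1
    cells.\<close>
  define rep where "rep A = (if p \<in> A then E - A else A)" for A
  define big where "big = {e \<in> E. 2 \<le> hs ! fst e}"
  define L where "L = (\<lambda>e. {e}) ` big"
  have bigE: "big \<subseteq> E" unfolding big_def by blast
  have finN: "finite N" using finite_subset[OF N finite_V] .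
  have finL: "finite L" unfolding L_def big_def using finite_cells by simp
  \<comment> \<open>A singleton crosses no set, so the sets of \<open>L\<close> can be added to
    \<open>N\<close> even where they are not vertices.\<close>
  have cross: "A \<subseteq> B \<or> B \<subseteq> A \<or> A \<inter> B = {} \<or> A \<union> B = E" if AB: "A \<in> N \<union> L" "B \<in> N \<union> L" for A B
  proof -
    consider a where "A = {a}" | b where "B = {b}" | "A \<in> N" "B \<in> N" "A \<noteq> B" | "A = B"
      using AB unfolding L_def by blast
    then show ?thesis
    proof cases
      case 3
      then show ?thesis using compat[OF 3] unfolding compat_def by metis
    qed auto
  qed
  have sub: "A \<subseteq> E \<and> A \<noteq> {} \<and> A \<noteq> E" if A: "A \<in> N \<union> L" for A
  proof (cases "A \<in> N")
    case True
    then have "A \<in> V" using N by (rule subsetD[rotated])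
    then show ?thesis using VD(1-3)[of A] by simp
  next
    case False
    then obtain a where "A = {a}" "a \<in> E" using A bigE unfolding L_def by blast
    moreover have "A \<noteq> E"
    proof
      assume "A = E"
      then have "card E = card {a}" using \<open>A = {a}\<close> by simp
      then show False using three_le_card_E by simp
    qed
    ultimately show ?thesis by simp
  qed
  have "rep A \<subseteq> rep B \<or> rep B \<subseteq> rep A \<or> rep A \<inter> rep B = {}" if "A \<in> N \<union> L" "B \<in> N \<union> L" for A B
  proof -
    have "A \<subseteq> E" "B \<subseteq> E" using sub that by auto
    then show ?thesis using cross[OF that] pE unfolding rep_def by (cases "p \<in> A"; cases "p \<in> B") auto
  qed
  then have lam: "laminar (rep ` (N \<union> L))" unfolding laminar_def by blast
  have "rep A \<in> Pow (E - {p}) - {{}}" if "A \<in> N \<union> L" for A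
    using sub[OF that] pE unfolding rep_def by auto
  then have "card (rep ` (N \<union> L)) \<le> 2 * card (E - {p}) - 1"
    using finite_cells by (intro card_laminar_le lam) auto
  then have up: "card (rep ` N \<union> rep ` L) \<le> 2 * (sum_list hs - 1) - 1"
    using pE finite_cells by (simp add: image_Un card_cells)
  have repD: "A = B \<or> B = E - A" if "rep A = rep B" "A \<in> N \<union> L" "B \<in> N \<union> L" for A B
  proof -
    have "A \<subseteq> E" "B \<subseteq> E" using sub that by auto
    then show ?thesis using that(1) unfolding rep_def by (cases "p \<in> A"; cases "p \<in> B") auto
  qed
  \<comment> \<open>Compatible vertices are not complementary, so \<open>rep\<close> merges none of
    them. For \<open>L\<close> the same holds because \<open>E\<close> has at least three
    cells.\<close>
  have "inj_on rep N"
  proof (rule inj_onI)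
    fix A B assume *: "A \<in> N" "B \<in> N" "rep A = rep B"
    then show "A = B" using repD[of A B] compat[of A B] unfolding compat_def by blast
  qed
  then have cN: "card (rep ` N) = card N" by (rule card_image)
  have "inj_on rep L"
  proof (rule inj_onI)
    fix A B assume *: "A \<in> L" "B \<in> L" "rep A = rep B"
    then obtain a b where ab: "A = {a}" "B = {b}" "a \<in> E" unfolding L_def using bigE by blast
    have "B \<noteq> E - A"
    proof
      assume "B = E - A"
      then have "E = {a, b}" using ab by blast
      then have "card E \<le> 2" by (simp add: card_insert_if)
      then show False using three_le_card_E by linarith
    qed
    then show "A = B" using repD[of A B] * by blast
  qed
  then have "card (rep ` L) = card L" by (rule card_image)
  also have "\<dots> = card big" unfolding L_def by (intro card_image) auto
  finally have cL: "card (rep ` L) + card singles = sum_list hs"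
    using card_big_cells unfolding big_def by simp
  \<comment> \<open>\<open>P\<close> and \<open>Q\<close> collect the members of \<open>N\<close>
    that \<open>L\<close> counts again, as singletons and as complements of singletons.\<close>
  define P where "P = N \<inter> L"
  define Q where "Q = N \<inter> (\<lambda>A. E - A) ` L"
  have nc: "{e} \<in> V \<Longrightarrow> E - {e} \<notin> V" if "e \<in> big" for e
    using that big_cell_not_complemented[of "fst e" "snd e"] unfolding big_def by auto
  \<comment> \<open>Neither singleton has a complement in \<open>V\<close>, so compatibility would
    require them to be nested.\<close>
  have "A = B" if AB: "A \<in> P" "B \<in> P" for A B
  proof (rule ccontr)
    assume ne: "A \<noteq> B"
    obtain a b where ab: "A = {a}" "B = {b}" "a \<in> big" "b \<in> big" using AB unfolding P_def L_def by blast
    have "A \<in> V" "B \<in> V" using AB N unfolding P_def by blast+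
    then show False
      using compat[of A B] AB ne nc[OF ab(3)] nc[OF ab(4)] ab(1,2) unfolding P_def compat_def by blast
  qed
  then have cP: "card P \<le> 1" by (simp add: card_le_Suc0_iff_eq P_def finN)
  \<comment> \<open>The complement of each member is a singleton outside \<open>V\<close>, as
    otherwise the member itself could not be a vertex. Again the two would have to be
    nested.\<close>
  have "A = B" if AB: "A \<in> Q" "B \<in> Q" for A B
  proof (rule ccontr)
    assume ne: "A \<noteq> B"
    obtain a b where ab: "A = E - {a}" "B = E - {b}" "a \<in> big" "b \<in> big"
      using AB unfolding Q_def L_def by blast
    have V: "A \<in> V" "B \<in> V" using AB N unfolding Q_def by blast+
    have "E - A = {a}" "E - B = {b}" using ab bigE by blast+
    then have "E - A \<notin> V" "E - B \<notin> V" using nc[OF ab(3)] nc[OF ab(4)] V ab(1,2) by auto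
    then have "A \<subseteq> B \<or> B \<subseteq> A"
      using compat[of A B] AB ne unfolding Q_def compat_def by blast
    then show False using ne ab bigE by blast
  qed
  then have cQ: "card Q \<le> 1" by (simp add: card_le_Suc0_iff_eq Q_def finN)
  have "rep ` N \<inter> rep ` L \<subseteq> rep ` (P \<union> Q)"
  proof
    fix x assume "x \<in> rep ` N \<inter> rep ` L"
    then obtain A B where AB: "A \<in> N" "B \<in> L" "x = rep A" "rep A = rep B" by auto
    then have "A = B \<or> A = E - B" using repD[of B A] by auto
    then show "x \<in> rep ` (P \<union> Q)" using AB unfolding P_def Q_def by blast
  qed
  then have "card (rep ` N \<inter> rep ` L) \<le> card (rep ` (P \<union> Q))"
    using finN unfolding P_def Q_def by (intro card_mono) auto
  also have "\<dots> \<le> card (P \<union> Q)"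
    using finN unfolding P_def Q_def by (intro card_image_le) auto
  also have "\<dots> \<le> 2" using card_Un_le[of P Q] cP cQ by linarith
  finally have "card (rep ` N) + card (rep ` L) \<le> card (rep ` N \<union> rep ` L) + 2"
    using card_Un_Int[of "rep ` N" "rep ` L"] finN finL by simp
  moreover have "sum_list hs \<ge> 3" using three_le_card_E by (simp add: card_cells)
  \<comment> \<open>With h cells and n field blocks this reads |N| + (h - n) \<le> 2 * (h - 1) - 1 +
    2, where h \<ge> 3 keeps the subtractions exact.\<close>
  ultimately show ?thesis using cN cL up by linarith
qed

text \<open>The resolving sets are exactly the complements in \<open>V\<close> of compatible
  families, so a smallest one is the complement of a largest family.\<close>

lemma least_resolving:
  "(LEAST k. \<exists>W. finite W \<and> resolving W \<and> card W = k) = card V - (sum_list hs - 1 + card singles)"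
proof (rule Least_equality)
  obtain N where N: "N \<subseteq> V" "card N = sum_list hs - 1 + card singles"
    "\<forall>u\<in>N. \<forall>v\<in>N. u \<noteq> v \<longrightarrow> compat u v"
    using ex_compat_family by (elim exE conjE)
  have "V - (V - N) = N" using N(1) by blast
  then have "resolving (V - N)" using N(3) by (intro compat_imp_resolving) auto
  moreover have "card (V - N) = card V - card N"
    using N(1) finite_subset[OF N(1) finite_V] by (simp add: card_Diff_subset)
  ultimately show "\<exists>W. finite W \<and> resolving W \<and> card W = card V - (sum_list hs - 1 + card singles)"
    using N(2) finite_V by (intro exI[of _ "V - N"]) auto
next
  fix k assume "\<exists>W. finite W \<and> resolving W \<and> card W = k"
  then obtain W where W: "finite W" "resolving W" "card W = k" by blast
  have "card (V - W) \<le> sum_list hs - 1 + card singles"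
    using resolving_imp_compat[OF W(2)] by (intro card_compat_family_le) auto
  moreover have "card (V - W) = card V - k"
    using W unfolding resolving_def by (simp add: card_Diff_subset)
  ultimately show "card V - (sum_list hs - 1 + card singles) \<le> k" by linarith
qed

text \<open>This makes the truncated difference in \<open>least_resolving\<close> a true
  one.\<close>

lemma card_family_bound_le_card_V: "sum_list hs - 1 + card singles \<le> card V"
  using ex_compat_family card_mono[OF finite_V] by metis

text \<open>Up to symmetry (0, 0) lies in \<open>u\<close>, so the complement v avoids block 0. The
  path is u, {(0, 0)}, {(0, 0)} \<union> v, v; the second cell of block 0 makes the first step
  proper and keeps {(0, 0)} \<union> v different from \<open>E\<close>.\<close>

lemma compl_path_length_3:
  assumes u: "u \<in> V" and c: "E - u \<in> V"
  shows "\<exists>a\<in>V. \<exists>b\<in>V. adj u a \<and> adj a b \<and> adj b (E - u)"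
proof -
  have E0: "(0, 0) \<in> E" "(0, 1) \<in> E" using two_le_length two_le_hd by auto
  have main: "\<exists>a\<in>V. \<exists>b\<in>V. adj u a \<and> adj a b \<and> adj b v"
    if u: "u \<in> V" and v: "v \<in> V" and uv: "u = E - v" and m: "(0, 0) \<in> u" for u v
  proof -
    have v0: "(0, 0) \<notin> v" using m uv by blast
    then have v1: "(0, 1) \<notin> v" using VD(4)[OF v, of 0 1 0] by auto
    have a: "{(0, 0)} \<in> V"
    proof (rule VI)
      show "{(0, 0)} \<noteq> E" using E0(2) by (metis Pair_inject singletonD zero_neq_one)
    qed (use E0 in auto)
    have b: "insert (0, 0) v \<in> V"
    proof (rule VI)
      show "insert (0, 0) v \<subseteq> E" using VD(1)[OF v] E0(1) by blast
      show "insert (0, 0) v \<noteq> E" using E0(2) v1 by (metis Pair_inject insertE zero_neq_one)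
      show "(i, r) \<in> insert (0, 0) v" if "(i, q) \<in> insert (0, 0) v" "r \<le> q" for i q r
        using that VD(4)[OF v, of i q r] by auto
    qed simp
    have "(0, 1) \<in> u" using uv v1 E0(2) by blast
    then have "adj u {(0, 0)}" using m unfolding adj_def by auto
    moreover have "adj {(0, 0)} (insert (0, 0) v)" using VD(2)[OF v] v0 unfolding adj_def by auto
    moreover have "adj (insert (0, 0) v) v" using v0 unfolding adj_def by auto
    ultimately show ?thesis using a b by blast
  qed
  show ?thesis
  proof (cases "(0, 0) \<in> u")
    case True
    have "u = E - (E - u)" using VD(1)[OF u] by blast
    then show ?thesis using main[OF u c] True by simp
  next
    case False
    then have "(0, 0) \<in> E - u" using E0(1) by simp
    then obtain a b where "a \<in> V" "b \<in> V" "adj (E - u) a" "adj a b" "adj b u"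
      using main[OF c u] by blast
    then show ?thesis using adj_commute by blast
  qed
qed

text \<open>The intersection is a common neighbour unless it is empty; in that case the union is
  one, as it cannot be \<open>E\<close>.\<close>

lemma ex_common_neighbour:
  assumes u: "u \<in> V" and v: "v \<in> V" and "\<not> adj u v" "u \<noteq> v" "v \<noteq> E - u"
  shows "\<exists>w\<in>V. adj u w \<and> adj w v"
proof (cases "u \<inter> v = {}")
  case True
  then have "u \<union> v \<noteq> E" using assms VD(1)[OF v] by blast
  then have "u \<union> v \<in> V" using Un_V u v by blast
  moreover have "adj u (u \<union> v)" "adj (u \<union> v) v" using assms(3,4) unfolding adj_def by blast+
  ultimately show ?thesis by blast
next
  case False
  then have "u \<inter> v \<in> V" using Int_V u v by blast
  moreover have "adj u (u \<inter> v)" "adj (u \<inter> v) v" using assms(3,4) unfolding adj_def by blast+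
  ultimately show ?thesis by blast
qed

end

section \<open>Bounded tuples and downsets\<close>

lemma list_all2_le_finite_card:
  "finite {xs. list_all2 (\<le>) xs hs} \<and> card {xs. list_all2 (\<le>) xs (hs::nat list)} = prod_list (map Suc hs)"
proof (induction hs)
  case (Cons h hs)
  have eq: "{xs. list_all2 (\<le>) xs (h # hs)} = (\<lambda>(x, xs). x # xs) ` ({..h} \<times> {xs. list_all2 (\<le>) xs hs})"
    by (auto simp: list_all2_Cons2)
  show ?case unfolding eq using Cons
    by (subst card_image) (auto simp: inj_on_def card_cartesian_product)
qed simp

lemma cells_subset_iff:
  assumes "length xs = length ys"
  shows "cells xs \<subseteq> cells ys \<longleftrightarrow> list_all2 (\<le>) xs ys"
proof
  assume s: "cells xs \<subseteq> cells ys"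
  have "xs ! i \<le> ys ! i" if "i < length xs" for i
  proof (rule ccontr)
    assume "\<not> ?thesis"
    then have "(i, ys ! i) \<in> cells xs" using that unfolding cells_def by auto
    then show False using s unfolding cells_def by auto
  qed
  then show "list_all2 (\<le>) xs ys" using assms by (simp add: list_all2_conv_all_nth)
next
  assume "list_all2 (\<le>) xs ys"
  then show "cells xs \<subseteq> cells ys"
    unfolding cells_def list_all2_conv_all_nth by (auto intro: less_le_trans)
qed

lemma bij_betw_cells: "bij_betw cells {xs. list_all2 (\<le>) xs hs} (downsets hs)"
proof (rule bij_betw_imageI)
  show "inj_on cells {xs. list_all2 (\<le>) xs hs}"
  proof (rule inj_onI)
    fix xs ys assume "xs \<in> {xs. list_all2 (\<le>) xs hs}" "ys \<in> {xs. list_all2 (\<le>) xs hs}" "cells xs = cells ys"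
    then have "length xs = length hs" "length ys = length hs" "cells xs \<subseteq> cells ys" "cells ys \<subseteq> cells xs"
      using list_all2_lengthD by auto
    then have "length xs = length ys" "list_all2 (\<le>) xs ys" "list_all2 (\<le>) ys xs"
      using cells_subset_iff[of xs ys] cells_subset_iff[of ys xs] by simp_all
    then show "xs = ys" by (auto simp: list_all2_conv_all_nth intro!: nth_equalityI le_antisym)
  qed
  show "cells ` {xs. list_all2 (\<le>) xs hs} = downsets hs"
  proof
    show "cells ` {xs. list_all2 (\<le>) xs hs} \<subseteq> downsets hs"
      unfolding cells_def downsets_def by (auto simp: list_all2_conv_all_nth)
    show "downsets hs \<subseteq> cells ` {xs. list_all2 (\<le>) xs hs}"
    proof
      fix D assume D: "D \<in> downsets hs"
      \<comment> \<open>The height of \<open>D\<close> in block i; the minimum exists because (i, hs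
        ! i) is never a cell. A downset contains exactly the cells below its heights.\<close>
      define f where "f i = (LEAST t. (i, t) \<notin> D)" for i
      define xs where "xs = map f [0..<length hs]"
      have nin: "(i, hs ! i) \<notin> D" for i using D unfolding downsets_def cells_def by auto
      have f1: "(i, f i) \<notin> D" for i unfolding f_def using LeastI[of "\<lambda>t. (i, t) \<notin> D"] nin by blast
      have f2: "(i, t) \<in> D" if "t < f i" for i t using not_less_Least that unfolding f_def by blast
      have f3: "(i, t) \<in> D \<longleftrightarrow> t < f i" for i t
        using f1 f2 D unfolding downsets_def by (metis (mono_tags, lifting) mem_Collect_eq not_less)
      have "f i \<le> hs ! i" for i using nin[of i] unfolding f_def by (rule Least_le)
      then have "list_all2 (\<le>) xs hs" unfolding xs_def by (simp add: list_all2_conv_all_nth)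
      moreover have "D = cells xs"
      proof -
        have "fst e < length hs" if "e \<in> D" for e using that D unfolding downsets_def cells_def by auto
        then show ?thesis unfolding xs_def cells_def using f3 by force
      qed
      ultimately show "D \<in> cells ` {xs. list_all2 (\<le>) xs hs}" by blast
    qed
  qed
qed

section \<open>Distances and strong resolving sets of the graph\<close>

context chain_product
begin

text \<open>The triangle inequality for \<open>d\<close> bounds the length of every walk from below,
  and explicit walks with at most three arcs attain the bound.\<close>

lemma graph_dist_eq:
  fixes G :: "'v pair_pre_digraph"
  assumes bij: "bij_betw \<phi> (pverts G) V"
    and arcs: "\<And>I J. (I, J) \<in> parcs G \<longleftrightarrow> I \<in> pverts G \<and> J \<in> pverts G \<and> adj (\<phi> I) (\<phi> J)"
    and I: "I \<in> pverts G" and J: "J \<in> pverts G"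
  shows "graph_dist (with_proj G) I J = ereal (real (d (\<phi> I) (\<phi> J)))"
proof -
  interpret pair_wf_digraph G using arcs by unfold_locales auto
  have \<phi>V: "\<phi> K \<in> V" if "K \<in> pverts G" for K using bij that by (rule bij_betwE[THEN bspec])
  have \<phi>inj: "K = L" if "K \<in> pverts G" "L \<in> pverts G" "\<phi> K = \<phi> L" for K L
    using bij that unfolding bij_betw_def by (auto dest: inj_onD)
  have \<phi>surj: "\<exists>K\<in>pverts G. \<phi> K = v" if "v \<in> V" for v
    using bij that unfolding bij_betw_def by (metis imageE)
  have cost: "awalk_cost (\<lambda>_. 1) p = real (length p)" for p :: "('v \<times> 'v) list"
    by (induction p) auto
  have lower: "d (\<phi> K) (\<phi> J) \<le> length p" if "awalk K p J" for K p
    using that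
  proof (induction p arbitrary: K)
    case Nil
    then show ?case by (simp add: awalk_Nil_iff d_def)
  next
    case (Cons e p)
    then have e: "e \<in> parcs G" "fst e = K" "awalk (snd e) p J" by (auto simp: awalk_Cons_iff)
    then have e': "K \<in> pverts G" "snd e \<in> pverts G" "adj (\<phi> K) (\<phi> (snd e))"
      using arcs[of K "snd e"] by (metis prod.collapse)+
    then have "d (\<phi> K) (\<phi> (snd e)) = 1" using d_eq_1 \<phi>V by blast
    moreover have "d (\<phi> K) (\<phi> J) \<le> d (\<phi> K) (\<phi> (snd e)) + d (\<phi> (snd e)) (\<phi> J)"
      using d_triangle \<phi>V e' J by blast
    ultimately show ?case using Cons.IH[OF e(3)] by simp
  qed
  have arc: "awalk K [(K, L)] L" if "K \<in> pverts G" "L \<in> pverts G" "adj (\<phi> K) (\<phi> L)" for K L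
    using that arcs by (simp add: arc_implies_awalk awalk_Cons_iff awalk_Nil_iff)
  have arcC: "awalk K ((K, L) # p) J" if "K \<in> pverts G" "L \<in> pverts G" "adj (\<phi> K) (\<phi> L)" "awalk L p J" for K L p
    using that arcs by (simp add: awalk_Cons_iff)
  have "\<exists>p. awalk I p J \<and> length p = d (\<phi> I) (\<phi> J)"
  proof -
    consider "I = J" | "I \<noteq> J" "adj (\<phi> I) (\<phi> J)"
      | "I \<noteq> J" "\<not> adj (\<phi> I) (\<phi> J)" "\<phi> J = E - \<phi> I"
      | "I \<noteq> J" "\<not> adj (\<phi> I) (\<phi> J)" "\<phi> J \<noteq> E - \<phi> I"
      by blast
    then show ?thesis
    proof cases
      case 1
      then show ?thesis using I by (intro exI[of _ "[]"]) (simp add: awalk_Nil_iff d_def)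
    next
      case 2
      then have "d (\<phi> I) (\<phi> J) = 1" using d_eq_1 \<phi>V I by blast
      then show ?thesis using arc[OF I J 2(2)] by (intro exI[of _ "[(I, J)]"]) simp
    next
      case 3
      obtain K L where KL: "K \<in> pverts G" "L \<in> pverts G" "adj (\<phi> I) (\<phi> K)" "adj (\<phi> K) (\<phi> L)" "adj (\<phi> L) (\<phi> J)"
        using compl_path_length_3[OF \<phi>V[OF I]] \<phi>V[OF J] 3(3) \<phi>surj by metis
      have "d (\<phi> I) (\<phi> J) = 3" using d_eq_3 \<phi>V I 3(3) by blast
      then show ?thesis
        using arcC[OF I KL(1,3) arcC[OF KL(1,2,4) arc[OF KL(2) J KL(5)]]]
        by (intro exI[of _ "[(I, K), (K, L), (L, J)]"]) simp
    next
      case 4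
      have ne: "\<phi> I \<noteq> \<phi> J" using \<phi>inj I J 4(1) by blast
      obtain K where K: "K \<in> pverts G" "adj (\<phi> I) (\<phi> K)" "adj (\<phi> K) (\<phi> J)"
        using ex_common_neighbour[OF \<phi>V[OF I] \<phi>V[OF J] 4(2) ne 4(3)] \<phi>surj by metis
      have "d (\<phi> I) (\<phi> J) = 2" using 4 ne unfolding d_def by simp
      then show ?thesis
        using arcC[OF I K(1,2) arc[OF K(1) J K(3)]]
        by (intro exI[of _ "[(I, K), (K, J)]"]) simp
    qed
  qed
  then obtain p where p: "awalk I p J" "length p = d (\<phi> I) (\<phi> J)" by blast
  show ?thesis
    unfolding graph_dist_def \<mu>_def cost
  proof (rule antisym)
    show "(INF p\<in>{p. awalk I p J}. ereal (real (length p))) \<le> ereal (real (d (\<phi> I) (\<phi> J)))"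
      using p by (intro INF_lower2[of p]) auto
    show "ereal (real (d (\<phi> I) (\<phi> J))) \<le> (INF p\<in>{p. awalk I p J}. ereal (real (length p)))"
      using lower by (intro INF_greatest) simp
  qed
qed

text \<open>The bijection carries strong resolving sets over in both directions and keeps their
  cardinality, so both minima range over the same sizes.\<close>

lemma sdim_eq:
  fixes G :: "'v pair_pre_digraph"
  assumes bij: "bij_betw \<phi> (pverts G) V"
    and arcs: "\<And>I J. (I, J) \<in> parcs G \<longleftrightarrow> I \<in> pverts G \<and> J \<in> pverts G \<and> adj (\<phi> I) (\<phi> J)"
  shows "sdim (with_proj G) = card V - (sum_list hs - 1 + card singles)"
proof -
  have \<phi>V: "\<phi> K \<in> V" if "K \<in> pverts G" for K using bij that by (rule bij_betwE[THEN bspec])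
  have inj: "inj_on \<phi> (pverts G)" and img: "\<phi> ` pverts G = V"
    using bij unfolding bij_betw_def by auto
  have res: "strongly_resolves (with_proj G) w u v \<longleftrightarrow> resolves (\<phi> w) (\<phi> u) (\<phi> v)"
    if "w \<in> pverts G" "u \<in> pverts G" "v \<in> pverts G" for w u v
    using that unfolding strongly_resolves_def resolves_def
    by (simp add: graph_dist_eq[OF bij arcs] flip: of_nat_add)
  have srs: "strong_resolving_set (with_proj G) W \<longleftrightarrow> resolving (\<phi> ` W)" if W: "W \<subseteq> pverts G" for W
  proof -
    have "(\<forall>u\<in>pverts G. \<forall>v\<in>pverts G. u \<noteq> v \<longrightarrow> (\<exists>w\<in>W. strongly_resolves (with_proj G) w u v)) \<longleftrightarrow>
      (\<forall>u\<in>pverts G. \<forall>v\<in>pverts G. \<phi> u \<noteq> \<phi> v \<longrightarrow> (\<exists>w\<in>W. resolves (\<phi> w) (\<phi> u) (\<phi> v)))"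
      using res W inj_onD[OF inj] by (intro ball_cong refl) (metis subsetD)
    then show ?thesis
      using W unfolding strong_resolving_set_def resolving_def img[symmetric] by (simp add: image_mono)
  qed
  have "(\<exists>W. finite W \<and> strong_resolving_set (with_proj G) W \<and> card W = k) \<longleftrightarrow>
        (\<exists>W. finite W \<and> resolving W \<and> card W = k)" for k
  proof
    assume "\<exists>W. finite W \<and> strong_resolving_set (with_proj G) W \<and> card W = k"
    then obtain W where W: "finite W" "strong_resolving_set (with_proj G) W" "card W = k" by blast
    then have sub: "W \<subseteq> pverts G" unfolding strong_resolving_set_def by simp
    then show "\<exists>W. finite W \<and> resolving W \<and> card W = k"
      using W srs[OF sub] card_image[OF inj_on_subset[OF inj sub]] by (intro exI[of _ "\<phi> ` W"]) simp
  next
    assume "\<exists>W. finite W \<and> resolving W \<and> card W = k"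
    then obtain W where W: "finite W" "resolving W" "card W = k" by blast
    then have "W \<subseteq> \<phi> ` pverts G" unfolding resolving_def img by blast
    then obtain U where U: "U \<subseteq> pverts G" "W = \<phi> ` U" by (auto simp: subset_image_iff)
    then show "\<exists>W. finite W \<and> strong_resolving_set (with_proj G) W \<and> card W = k"
      using W srs[OF U(1)] inj_on_subset[OF inj U(1)]
      by (intro exI[of _ U]) (simp add: card_image finite_image_iff)
  qed
  then show ?thesis unfolding sdim_def least_resolving[symmetric] by simp
qed

end

section \<open>Lattices of ideals\<close>

abbreviation ideals :: "('a, 'b) ring_scheme \<Rightarrow> 'a set set" where
  "ideals R \<equiv> {I. ideal I R}"

text \<open>An order isomorphism between the ideals and a product of chains, the i-th of which has
  \<open>hs ! i\<close> + 1 elements.\<close>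

definition ideals_like_box :: "('a, 'b) ring_scheme \<Rightarrow> nat list \<Rightarrow> bool" where
  "ideals_like_box R hs \<longleftrightarrow>
     (\<exists>f. bij_betw f (ideals R) {xs. list_all2 (\<le>) xs hs} \<and>
          (\<forall>I J. ideal I R \<longrightarrow> ideal J R \<longrightarrow> (I \<subseteq> J \<longleftrightarrow> list_all2 (\<le>) (f I) (f J))))"

lemma list_all2_le_singleton: "{xs. list_all2 (\<le>) xs [N::nat]} = (\<lambda>k. [k]) ` {..N}"
  by (auto simp: list_all2_Cons2)

text \<open>An ideal is sent to the number of ideals strictly inside it; on a chain of N + 1 ideals
  these ranks are 0, ..., N and reflect inclusion.\<close>

lemma linear_ideals_like_box:
  assumes lin: "\<And>I J. ideal I R \<Longrightarrow> ideal J R \<Longrightarrow> I \<subseteq> J \<or> J \<subseteq> I"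
    and card: "card (ideals R) = Suc N"
  shows "ideals_like_box R [N]"
proof -
  have fin: "finite (ideals R)" using card by (intro card_ge_0_finite) simp
  define r where "r I = card {J \<in> ideals R. J \<subset> I}" for I
  have mono: "r I < r J" if "ideal I R" "ideal J R" "I \<subset> J" for I J
    unfolding r_def using fin that by (intro psubset_card_mono) auto
  have le: "I \<subseteq> J \<longleftrightarrow> r I \<le> r J" if "ideal I R" "ideal J R" for I J
    using lin[OF that] mono[OF that] mono[OF that(2,1)] by (cases "I = J") (auto simp: psubset_eq)
  have inj: "inj_on r (ideals R)"
    using le by (intro inj_onI) (simp add: set_eq_subset)
  have "r I \<le> N" if "ideal I R" for I
  proof -
    have "r I < card (ideals R)"
      unfolding r_def using fin that by (intro psubset_card_mono) auto
    then show ?thesis using card by simp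
  qed
  then have "r ` ideals R \<subseteq> {..N}" by auto
  then have "r ` ideals R = {..N}"
    using card_image[OF inj] card by (intro card_subset_eq) auto
  then have "bij_betw r (ideals R) {..N}" using inj by (simp add: bij_betw_def)
  moreover have "bij_betw (\<lambda>k. [k]) {..N} {xs. list_all2 (\<le>) xs [N]}"
    unfolding list_all2_le_singleton by (intro inj_on_imp_bij_betw) (simp add: inj_on_def)
  ultimately have "bij_betw (\<lambda>I. [r I]) (ideals R) {xs. list_all2 (\<le>) xs [N]}"
    using bij_betw_trans[of r "ideals R" "{..N}" "\<lambda>k. [k]"] by (simp add: comp_def)
  then show ?thesis unfolding ideals_like_box_def using le by (intro exI[of _ "\<lambda>I. [r I]"]) simp
qed

lemma ideals_like_box_iso:
  assumes R: "ring R" and S: "ring S" and iso: "R \<simeq> S" and box: "ideals_like_box S hs"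
  shows "ideals_like_box R hs"
proof -
  obtain h where h: "h \<in> ring_iso R S" using iso unfolding is_ring_iso_def by blast
  then have hb: "bij_betw h (carrier R) (carrier S)" and hh: "h \<in> ring_hom R S"
    unfolding ring_iso_def by auto
  define g where "g = inv_into (carrier R) h"
  have g: "g \<in> ring_iso S R" unfolding g_def by (rule ring_iso_set_sym[OF R h])
  then have gh: "g \<in> ring_hom S R" unfolding ring_iso_def by auto
  interpret h: ring_hom_ring R S h using R S hh by (simp add: ring_hom_ring_def ring_hom_ring_axioms_def)
  interpret g: ring_hom_ring S R g using R S gh by (simp add: ring_hom_ring_def ring_hom_ring_axioms_def)
  have gh1: "g (h x) = x" if "x \<in> carrier R" for x
    using hb that unfolding g_def by (simp add: bij_betw_inv_into_left)
  have hg1: "h (g y) = y" if "y \<in> carrier S" for y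
    using hb that unfolding g_def by (simp add: bij_betw_inv_into_right)
  have sub: "I \<subseteq> carrier R" if "ideal I R" for I
    using that by (simp add: additive_subgroup.a_subset ideal.axioms(1))
  have sub': "I \<subseteq> carrier S" if "ideal I S" for I
    using that by (simp add: additive_subgroup.a_subset ideal.axioms(1))
  have img: "ideal (h ` I) S" if "ideal I R" for I
  proof -
    \<comment> \<open>The image is the preimage under the inverse isomorphism, and preimages of
      ideals under homomorphisms are ideals.\<close>
    have "h ` I = {r \<in> carrier S. g r \<in> I}"
    proof (intro equalityI subsetI)
      fix y assume "y \<in> h ` I"
      then obtain x where "x \<in> I" "y = h x" by auto
      then show "y \<in> {r \<in> carrier S. g r \<in> I}" using gh1[of x] sub[OF that] by auto
    next
      fix y assume y: "y \<in> {r \<in> carrier S. g r \<in> I}"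
      then have "y = h (g y)" using hg1 by simp
      then show "y \<in> h ` I" using y by blast
    qed
    then show ?thesis using g.ideal_vimage[OF that] by simp
  qed
  have inj: "inj_on h (carrier R)" using hb by (rule bij_betw_imp_inj_on)
  have bij: "bij_betw ((`) h) (ideals R) (ideals S)"
  proof (rule bij_betw_imageI)
    show "inj_on ((`) h) (ideals R)"
      using inj sub by (intro inj_onI) (simp add: inj_on_image_eq_iff)
    show "(`) h ` ideals R = ideals S"
    proof (intro equalityI subsetI)
      fix J assume "J \<in> (`) h ` ideals R"
      then show "J \<in> ideals S" using img by auto
    next
      fix J assume "J \<in> ideals S"
      then have J: "ideal J S" by simp
      have "h ` {r \<in> carrier R. h r \<in> J} = J"
      proof (intro equalityI subsetI)
        fix y assume y: "y \<in> J"
        then have yS: "y \<in> carrier S" using sub'[OF J] by blast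
        then have "y = h (g y)" "g y \<in> carrier R" using hg1 by simp_all
        then show "y \<in> h ` {r \<in> carrier R. h r \<in> J}" using y by (metis (mono_tags, lifting) image_eqI mem_Collect_eq)
      qed auto
      then show "J \<in> (`) h ` ideals R" using h.ideal_vimage[OF J] by blast
    qed
  qed
  obtain f where f: "bij_betw f (ideals S) {xs. list_all2 (\<le>) xs hs}"
    "\<And>I J. ideal I S \<Longrightarrow> ideal J S \<Longrightarrow> I \<subseteq> J \<longleftrightarrow> list_all2 (\<le>) (f I) (f J)"
    using box unfolding ideals_like_box_def by auto
  have "bij_betw (f \<circ> (`) h) (ideals R) {xs. list_all2 (\<le>) xs hs}"
    by (rule bij_betw_trans[OF bij f(1)])
  moreover have "I \<subseteq> J \<longleftrightarrow> list_all2 (\<le>) ((f \<circ> (`) h) I) ((f \<circ> (`) h) J)" if I: "ideal I R" and J: "ideal J R" for I J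
  proof -
    have "h ` I \<subseteq> h ` J \<longleftrightarrow> I \<subseteq> J"
    proof -
      have "h x \<in> h ` J \<longleftrightarrow> x \<in> J" if "x \<in> I" for x
        using inj_on_image_mem_iff[OF inj _ sub[OF J]] sub[OF I] that by blast
      then show ?thesis by (simp add: image_subset_iff subset_eq)
    qed
    then show ?thesis using f(2)[OF img[OF I] img[OF J]] by simp
  qed
  ultimately show ?thesis unfolding ideals_like_box_def by blast
qed

section \<open>Ideals of direct products\<close>

lemma RDirProd_simps:
  "carrier (RDirProd A B) = carrier A \<times> carrier B"
  "\<zero>\<^bsub>RDirProd A B\<^esub> = (\<zero>\<^bsub>A\<^esub>, \<zero>\<^bsub>B\<^esub>)"
  "\<one>\<^bsub>RDirProd A B\<^esub> = (\<one>\<^bsub>A\<^esub>, \<one>\<^bsub>B\<^esub>)"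
  "(a, b) \<otimes>\<^bsub>RDirProd A B\<^esub> (a', b') = (a \<otimes>\<^bsub>A\<^esub> a', b \<otimes>\<^bsub>B\<^esub> b')"
  "(a, b) \<oplus>\<^bsub>RDirProd A B\<^esub> (a', b') = (a \<oplus>\<^bsub>A\<^esub> a', b \<oplus>\<^bsub>B\<^esub> b')"
  unfolding RDirProd_def DirProd_def by (auto simp: monoid.defs)

lemma fst_ring_hom: "fst \<in> ring_hom (RDirProd A B) A"
  by (auto simp: ring_hom_def RDirProd_simps)

lemma snd_ring_hom: "snd \<in> ring_hom (RDirProd A B) B"
  by (auto simp: ring_hom_def RDirProd_simps)

text \<open>The product is the intersection of the preimages of \<open>I\<close> and
  \<open>J\<close> under the two projections.\<close>

lemma ideal_Times:
  assumes A: "ring A" and B: "ring B" and I: "ideal I A" and J: "ideal J B"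
  shows "ideal (I \<times> J) (RDirProd A B)"
proof -
  have P: "ring (RDirProd A B)" using RDirProd_ring[OF A B] .
  interpret P: ring "RDirProd A B" by (rule P)
  interpret f: ring_hom_ring "RDirProd A B" A fst
    using A P fst_ring_hom by (simp add: ring_hom_ring_def ring_hom_ring_axioms_def)
  interpret s: ring_hom_ring "RDirProd A B" B snd
    using B P snd_ring_hom by (simp add: ring_hom_ring_def ring_hom_ring_axioms_def)
  have "I \<subseteq> carrier A" "J \<subseteq> carrier B"
    using I J by (simp_all add: additive_subgroup.a_subset ideal.axioms(1))
  then have "I \<times> J = {r \<in> carrier (RDirProd A B). fst r \<in> I} \<inter> {r \<in> carrier (RDirProd A B). snd r \<in> J}"
    by (auto simp: RDirProd_simps)
  then show ?thesis using P.i_intersect[OF f.ideal_vimage[OF I] s.ideal_vimage[OF J]] by simp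
qed

text \<open>Multiplication by (1, 0) and (0, 1) splits every element of \<open>K\<close> into its
  components, so \<open>K\<close> is the product of its slices along the two axes.\<close>

lemma ideal_RDirProd_eq_Times:
  assumes A: "ring A" and B: "ring B" and K: "ideal K (RDirProd A B)"
  shows "\<exists>I J. ideal I A \<and> ideal J B \<and> K = I \<times> J"
proof -
  interpret A: ring A by (rule A)
  interpret B: ring B by (rule B)
  interpret P: ring "RDirProd A B" by (rule RDirProd_ring[OF A B])
  interpret K: ideal K "RDirProd A B" by (rule K)
  let ?I = "{a \<in> carrier A. (a, \<zero>\<^bsub>B\<^esub>) \<in> K}" and ?J = "{b \<in> carrier B. (\<zero>\<^bsub>A\<^esub>, b) \<in> K}"
  have add: "(a \<oplus>\<^bsub>A\<^esub> a', b \<oplus>\<^bsub>B\<^esub> b') \<in> K" if "(a, b) \<in> K" "(a', b') \<in> K" for a b a' b'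
    using K.a_closed[OF that] by (simp add: RDirProd_simps)
  have mult: "(x \<otimes>\<^bsub>A\<^esub> a, y \<otimes>\<^bsub>B\<^esub> b) \<in> K" "(a \<otimes>\<^bsub>A\<^esub> x, b \<otimes>\<^bsub>B\<^esub> y) \<in> K"
    if "(a, b) \<in> K" "x \<in> carrier A" "y \<in> carrier B" for a b x y
    using K.I_l_closed[OF that(1), of "(x, y)"] K.I_r_closed[OF that(1), of "(x, y)"] that
    by (simp_all add: RDirProd_simps)
  have car: "a \<in> carrier A" "b \<in> carrier B" if "(a, b) \<in> K" for a b
    using K.Icarr[OF that] by (simp_all add: RDirProd_simps)
  have zero: "(\<zero>\<^bsub>A\<^esub>, \<zero>\<^bsub>B\<^esub>) \<in> K" using K.zero_closed by (simp add: RDirProd_simps)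
  have "ideal ?I A"
  proof (rule idealI[OF A])
    show "subgroup ?I (add_monoid A)"
    proof (rule A.add.subgroupI)
      show "\<ominus>\<^bsub>A\<^esub> a \<in> ?I" if "a \<in> ?I" for a
        using mult(1)[of a "\<zero>\<^bsub>B\<^esub>" "\<ominus>\<^bsub>A\<^esub> \<one>\<^bsub>A\<^esub>" "\<zero>\<^bsub>B\<^esub>"] that by (simp add: A.l_minus)
      show "a \<oplus>\<^bsub>A\<^esub> b \<in> ?I" if "a \<in> ?I" "b \<in> ?I" for a b
        using add[of a "\<zero>\<^bsub>B\<^esub>" b "\<zero>\<^bsub>B\<^esub>"] that by simp
    qed (use zero in auto)
    show "x \<otimes>\<^bsub>A\<^esub> a \<in> ?I" "a \<otimes>\<^bsub>A\<^esub> x \<in> ?I" if "a \<in> ?I" "x \<in> carrier A" for a x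
      using mult[of a "\<zero>\<^bsub>B\<^esub>" x "\<zero>\<^bsub>B\<^esub>"] that by simp_all
  qed
  moreover have "ideal ?J B"
  proof (rule idealI[OF B])
    show "subgroup ?J (add_monoid B)"
    proof (rule B.add.subgroupI)
      show "\<ominus>\<^bsub>B\<^esub> b \<in> ?J" if "b \<in> ?J" for b
        using mult(1)[of "\<zero>\<^bsub>A\<^esub>" b "\<zero>\<^bsub>A\<^esub>" "\<ominus>\<^bsub>B\<^esub> \<one>\<^bsub>B\<^esub>"] that by (simp add: B.l_minus)
      show "a \<oplus>\<^bsub>B\<^esub> b \<in> ?J" if "a \<in> ?J" "b \<in> ?J" for a b
        using add[of "\<zero>\<^bsub>A\<^esub>" a "\<zero>\<^bsub>A\<^esub>" b] that by simp
    qed (use zero in auto)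
    show "x \<otimes>\<^bsub>B\<^esub> b \<in> ?J" "b \<otimes>\<^bsub>B\<^esub> x \<in> ?J" if "b \<in> ?J" "x \<in> carrier B" for b x
      using mult[of "\<zero>\<^bsub>A\<^esub>" b "\<zero>\<^bsub>A\<^esub>" x] that by simp_all
  qed
  moreover have "K = ?I \<times> ?J"
  proof (intro equalityI subrelI)
    fix a b assume ab: "(a, b) \<in> K"
    note c = car[OF ab]
    show "(a, b) \<in> ?I \<times> ?J"
      using mult(1)[OF ab, of "\<one>\<^bsub>A\<^esub>" "\<zero>\<^bsub>B\<^esub>"] mult(1)[OF ab, of "\<zero>\<^bsub>A\<^esub>" "\<one>\<^bsub>B\<^esub>"] c by simp
  next
    fix a b assume ab: "(a, b) \<in> ?I \<times> ?J"
    then show "(a, b) \<in> K" using add[of a "\<zero>\<^bsub>B\<^esub>" "\<zero>\<^bsub>A\<^esub>" b] by simp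
  qed
  ultimately show ?thesis by blast
qed

lemma list_all2_le_append:
  "{zs. list_all2 (\<le>) zs (xs @ ys)} = (\<lambda>(us, vs). us @ vs) ` ({us. list_all2 (\<le>) us xs} \<times> {vs. list_all2 (\<le>) vs ys})"
proof (intro equalityI subsetI)
  fix zs assume "zs \<in> {zs. list_all2 (\<le>) zs (xs @ ys)}"
  then obtain us vs where "zs = us @ vs" "list_all2 (\<le>) us xs" "list_all2 (\<le>) vs ys"
    by (auto simp: list_all2_append2)
  then show "zs \<in> (\<lambda>(us, vs). us @ vs) ` ({us. list_all2 (\<le>) us xs} \<times> {vs. list_all2 (\<le>) vs ys})"
    by (intro image_eqI[of _ _ "(us, vs)"]) auto
qed (auto intro: list_all2_appendI)

lemma ideals_like_box_RDirProd:
  assumes A: "ring A" and B: "ring B" and boxA: "ideals_like_box A xs" and boxB: "ideals_like_box B ys"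
  shows "ideals_like_box (RDirProd A B) (xs @ ys)"
proof -
  obtain f where f: "bij_betw f (ideals A) {us. list_all2 (\<le>) us xs}"
    "\<And>I J. ideal I A \<Longrightarrow> ideal J A \<Longrightarrow> I \<subseteq> J \<longleftrightarrow> list_all2 (\<le>) (f I) (f J)"
    using boxA unfolding ideals_like_box_def by auto
  obtain g where g: "bij_betw g (ideals B) {vs. list_all2 (\<le>) vs ys}"
    "\<And>I J. ideal I B \<Longrightarrow> ideal J B \<Longrightarrow> I \<subseteq> J \<longleftrightarrow> list_all2 (\<le>) (g I) (g J)"
    using boxB unfolding ideals_like_box_def by auto
  have neA: "I \<noteq> {}" if "ideal I A" for I
    using that additive_subgroup.zero_closed ideal.axioms(1) by fastforce
  have neB: "I \<noteq> {}" if "ideal I B" for I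
    using that additive_subgroup.zero_closed ideal.axioms(1) by fastforce
  have lenf: "length (f I) = length xs" if "ideal I A" for I
    using bij_betwE[OF f(1)] that list_all2_lengthD by blast
  \<comment> \<open>Projecting I \<times> J recovers both factors because ideals are
    nonempty.\<close>
  define F where "F K = f (fst ` K) @ g (snd ` K)" for K
  have F: "F (I \<times> J) = f I @ g J" if "ideal I A" "ideal J B" for I J
    using neA[OF that(1)] neB[OF that(2)] unfolding F_def by simp
  have ideals: "ideals (RDirProd A B) = (\<lambda>(I, J). I \<times> J) ` (ideals A \<times> ideals B)"
    using ideal_RDirProd_eq_Times[OF A B] ideal_Times[OF A B] by (auto simp: image_iff) 
  have le: "I \<times> J \<subseteq> I' \<times> J' \<longleftrightarrow> list_all2 (\<le>) (F (I \<times> J)) (F (I' \<times> J'))"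
    if "ideal I A" "ideal J B" "ideal I' A" "ideal J' B" for I J I' J'
    using that neA neB f(2) g(2) lenf by (simp add: F times_subset_iff list_all2_append)
  have le': "K \<subseteq> L \<longleftrightarrow> list_all2 (\<le>) (F K) (F L)" if "K \<in> ideals (RDirProd A B)" "L \<in> ideals (RDirProd A B)" for K L
  proof -
    obtain I J I' J' where *: "ideal I A" "ideal J B" "ideal I' A" "ideal J' B" "K = I \<times> J" "L = I' \<times> J'"
      using \<open>K \<in> ideals (RDirProd A B)\<close> \<open>L \<in> ideals (RDirProd A B)\<close> unfolding ideals by auto
    show ?thesis unfolding *(5,6) by (rule le[OF *(1-4)])
  qed
  have "inj_on F (ideals (RDirProd A B))"
  proof (rule inj_onI)
    fix K L assume *: "K \<in> ideals (RDirProd A B)" "L \<in> ideals (RDirProd A B)" "F K = F L"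
    \<comment> \<open>As \<open>F K = F L\<close>, reflexivity yields both inclusions between
      \<open>K\<close> and \<open>L\<close>.\<close>
    have "list_all2 (\<le>) (F L) (F L)" by (simp add: list_all2_refl)
    then show "K = L" using le'[of K L] le'[of L K] * by auto
  qed
  moreover have "F ` ideals (RDirProd A B) = {zs. list_all2 (\<le>) zs (xs @ ys)}"
  proof -
    have "F ` ideals (RDirProd A B) = (\<lambda>(I, J). f I @ g J) ` (ideals A \<times> ideals B)"
      unfolding ideals image_image by (intro image_cong refl) (auto simp: F)
    also have "\<dots> = (\<lambda>(us, vs). us @ vs) ` (f ` ideals A \<times> g ` ideals B)"
      by force
    also have "\<dots> = {zs. list_all2 (\<le>) zs (xs @ ys)}"
      using f(1) g(1) unfolding list_all2_le_append bij_betw_def by simp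
    finally show ?thesis .
  qed
  ultimately have "bij_betw F (ideals (RDirProd A B)) {zs. list_all2 (\<le>) zs (xs @ ys)}"
    by (simp add: bij_betw_def)
  then show ?thesis unfolding ideals_like_box_def using le' by (intro exI[of _ F]) simp
qed

text \<open>The empty product is the zero ring, whose only ideal corresponds to the empty
  tuple.\<close>

lemma ideals_like_box_nil_ring: "ideals_like_box (nil_ring :: 'a list ring) []"
proof -
  have "ring (RDirProd_list [] :: 'a list ring)" by (rule RDirProd_list_is_ring) simp
  then interpret ring "nil_ring :: 'a list ring" by simp
  have *: "ideals (nil_ring :: 'a list ring) = {{[]}}"
  proof (intro equalityI subsetI)
    fix I :: "'a list set" assume "I \<in> ideals (nil_ring :: 'a list ring)"
    then have I: "additive_subgroup I (nil_ring :: 'a list ring)" by (simp add: ideal.axioms(1))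
    have "I \<subseteq> {[]}" "[] \<in> I"
      using additive_subgroup.a_subset[OF I] additive_subgroup.zero_closed[OF I] by (simp_all add: monoid.defs)
    then show "I \<in> {{[]}}" by blast
  next
    fix I :: "'a list set" assume "I \<in> {{[]}}"
    then show "I \<in> ideals (nil_ring :: 'a list ring)" using zeroideal by (simp add: monoid.defs)
  qed
  have "bij_betw (\<lambda>_. []) (ideals (nil_ring :: 'a list ring)) {xs. list_all2 (\<le>) xs ([] :: nat list)}"
    unfolding * by (simp add: bij_betw_def)
  moreover have "I \<subseteq> J \<longleftrightarrow> list_all2 (\<le>) ([] :: nat list) []"
    if "ideal I (nil_ring :: 'a list ring)" "ideal J (nil_ring :: 'a list ring)" for I J
  proof -
    have "I \<in> {{[]}}" "J \<in> {{[]}}" using that unfolding *[symmetric] by blast+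
    then show ?thesis by simp
  qed
  ultimately show ?thesis
    unfolding ideals_like_box_def by (intro exI[of _ "\<lambda>_. []"]) blast
qed

lemma ideals_like_box_RDirProd_list:
  assumes "list_all2 (\<lambda>A h. ring A \<and> ideals_like_box A [h]) Rs hs"
  shows "ideals_like_box (RDirProd_list Rs) hs"
  using assms
proof (induction Rs hs rule: list_all2_induct)
  case Nil
  then show ?case using ideals_like_box_nil_ring by simp
next
  case (Cons A Rs h hs)
  have rings: "ring (Rs ! i)" if "i < length Rs" for i
    using Cons.hyps(2) that by (auto simp: list_all2_conv_all_nth)
  then have r: "ring (RDirProd_list Rs)" by (intro RDirProd_list_is_ring)
  have "ring (RDirProd_list (A # Rs))"
    using rings Cons.hyps(1) by (intro RDirProd_list_is_ring) (auto simp: nth_Cons split: nat.split)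
  moreover have "RDirProd_list (A # Rs) \<simeq> RDirProd A (RDirProd_list Rs)"
    using RDirProd_list_iso2 unfolding is_ring_iso_def by blast
  ultimately show ?case
    using ideals_like_box_iso RDirProd_ring[of A] ideals_like_box_RDirProd[of A _ "[h]" hs] Cons r by fastforce
qed

section \<open>Local Artinian principal ideal rings\<close>

context local_artinian_principal_ring
begin

text \<open>In a Noetherian ring the union of a nonempty chain of ideals belongs to the chain, which
  keeps unions of proper ideals proper in the Zorn argument for maximal ideals.\<close>

lemma noetherian: "noetherian_ring R"
proof (rule noetherian_ringI)
  fix I assume "ideal I R"
  then obtain i where "i \<in> carrier R" "I = Idl {i}"
    using principalideal.generate[OF all_principal] by blast
  then show "\<exists>A\<subseteq>carrier R. finite A \<and> I = Idl A" by (intro exI[of _ "{i}"]) simp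
qed

lemma ex_PIdl: "ideal I R \<Longrightarrow> \<exists>i\<in>carrier R. I = PIdl i"
  using principalideal.generate[OF all_principal] cgenideal_eq_genideal by metis

lemma ideal_subset_carrier: "ideal I R \<Longrightarrow> I \<subseteq> carrier R"
  by (simp add: additive_subgroup.a_subset ideal.axioms(1))

lemma ex_maximalideal_superset:
  assumes "ideal I R" "I \<noteq> carrier R"
  shows "\<exists>M. maximalideal M R \<and> I \<subseteq> M"
proof -
  let ?A = "{J. ideal J R \<and> I \<subseteq> J \<and> J \<noteq> carrier R}"
  have "\<exists>M\<in>?A. \<forall>X\<in>?A. M \<subseteq> X \<longrightarrow> X = M"
  proof (rule subset_Zorn_nonempty)
    fix C assume C: "C \<noteq> {}" "subset.chain ?A C"
    then have "subset.chain (ideals R) C" by (auto simp: subset.chain_def)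
    then have "\<Union>C \<in> C" using noetherian_ring.ideal_chain_is_trivial[OF noetherian C(1)] by blast
    then show "\<Union>C \<in> ?A" using C(2) unfolding subset.chain_def by blast
  qed (use assms in auto)
  then obtain M where M: "ideal M R" "I \<subseteq> M" "M \<noteq> carrier R"
    "\<forall>X\<in>?A. M \<subseteq> X \<longrightarrow> X = M" by blast
  have "maximalideal M R"
  proof (rule maximalidealI)
    show "J = M \<or> J = carrier R" if "ideal J R" "M \<subseteq> J" "J \<subseteq> carrier R" for J
      using M that by blast
  qed (use M in auto)
  then show ?thesis using M by blast
qed

lemma PIdl_unit_mult:
  assumes "a \<in> Units R" "x \<in> carrier R"
  shows "PIdl (a \<otimes> x) = PIdl x"
proof
  have a: "a \<in> carrier R" using assms(1) by (rule Units_closed)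
  show "PIdl (a \<otimes> x) \<subseteq> PIdl x"
    using cgenideal_minimal[OF cgenideal_ideal[OF assms(2)]] a unfolding cgenideal_def by blast
  have "x = inv a \<otimes> (a \<otimes> x)" using assms a by (simp flip: m_assoc)
  then have "x \<in> PIdl (a \<otimes> x)" using assms unfolding cgenideal_def by blast
  then show "PIdl x \<subseteq> PIdl (a \<otimes> x)"
    using cgenideal_minimal[OF cgenideal_ideal] a assms(2) by blast
qed

text \<open>The maximal ideal is generated by a nilpotent element, and every element is a unit times a
  power of it.\<close>

lemma ideals_eq_powers: "\<exists>p\<in>carrier R. \<exists>N::nat. \<forall>I. ideal I R \<longrightarrow> (\<exists>k\<le>N. I = PIdl (p [^] k))"
proof -
  obtain M where M: "maximalideal M R" "\<And>M'. maximalideal M' R \<Longrightarrow> M' = M"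
    using unique_maximalideal by blast
  have Mi: "ideal M R" "carrier R \<noteq> M" using M(1) by (auto simp: maximalideal_def maximalideal_axioms_def)
  obtain p where p: "p \<in> carrier R" "M = PIdl p" using ex_PIdl[OF Mi(1)] by blast
  \<comment> \<open>An element outside the only maximal ideal lies in no maximal ideal, so it
    generates the whole ring.\<close>
  have unit: "x \<in> Units R" if "x \<in> carrier R" "x \<notin> M" for x
  proof -
    have "PIdl x = carrier R"
      using ex_maximalideal_superset[OF cgenideal_ideal[OF that(1)]] M(2) cgenideal_self[OF that(1)] that(2)
      by blast
    then have "\<one> \<in> PIdl x" by simp
    then obtain y where "y \<in> carrier R" "y \<otimes> x = \<one>" unfolding cgenideal_def by auto
    then show ?thesis using that(1) m_comm[of x y] unfolding Units_def by auto
  qed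
  have one: "\<one> \<notin> M" using ideal.one_imp_carrier[OF Mi(1)] Mi(2) by blast
  \<comment> \<open>Where the chain of powers becomes stationary, p^N = a p^(N+1). As a p lies in
    \<open>M\<close>, 1 - a p is a unit; it annihilates p^N, whence p^N = 0.\<close>
  have "\<exists>N::nat. \<forall>k\<ge>N. PIdl (p [^] k) = PIdl (p [^] N)"
  proof (rule descending_chain[of "\<lambda>k. PIdl (p [^] k)"])
    show "ideal (PIdl (p [^] k)) R" for k :: nat using p by (intro cgenideal_ideal) simp
    show "PIdl (p [^] Suc k) \<subseteq> PIdl (p [^] k)" for k :: nat
    proof (rule cgenideal_minimal)
      have "p [^] Suc k = p \<otimes> p [^] k" using p m_comm by simp
      then show "p [^] Suc k \<in> PIdl (p [^] k)" using p unfolding cgenideal_def by blast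
    qed (use p in \<open>simp add: cgenideal_ideal\<close>)
  qed
  then obtain N :: nat where N: "\<And>k. k \<ge> N \<Longrightarrow> PIdl (p [^] k) = PIdl (p [^] N)" by blast
  have "p [^] N \<in> PIdl (p [^] Suc N)" using N[of "Suc N"] cgenideal_self[of "p [^] N"] p by simp
  then obtain a where a: "a \<in> carrier R" "p [^] N = a \<otimes> p [^] Suc N" unfolding cgenideal_def by blast
  have ap: "a \<otimes> p \<in> M" using a(1) p unfolding cgenideal_def by blast
  have apc: "a \<otimes> p \<in> carrier R" using a p by simp
  have "\<one> \<ominus> a \<otimes> p \<notin> M"
  proof
    assume "\<one> \<ominus> a \<otimes> p \<in> M"
    then have "(\<one> \<ominus> a \<otimes> p) \<oplus> a \<otimes> p \<in> M"
      using ap ideal.axioms(1)[OF Mi(1)] by (simp add: additive_subgroup.a_closed)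
    moreover have "(\<one> \<ominus> a \<otimes> p) \<oplus> a \<otimes> p = \<one>"
      using apc by (simp add: a_minus_def a_assoc l_neg)
    ultimately show False using one by simp
  qed
  then have u: "\<one> \<ominus> a \<otimes> p \<in> Units R" using unit apc by simp
  have "(\<one> \<ominus> a \<otimes> p) \<otimes> p [^] N = \<zero>"
  proof -
    have "(\<one> \<ominus> a \<otimes> p) \<otimes> p [^] N = p [^] N \<ominus> (a \<otimes> p) \<otimes> p [^] N"
      using apc p by (simp add: a_minus_def l_distr l_minus)
    also have "(a \<otimes> p) \<otimes> p [^] N = a \<otimes> p [^] Suc N"
      using a(1) p m_comm[of p "p [^] N"] by (simp add: m_assoc)
    also have "\<dots> = p [^] N" by (rule a(2)[symmetric])
    finally show ?thesis using p by (simp add: a_minus_def r_neg)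
  qed
  then have pN: "p [^] N = \<zero>"
    using u p by (metis Units_l_cancel nat_pow_closed r_null zero_closed Units_closed)
  have "\<exists>k\<le>N. I = PIdl (p [^] k)" if I: "ideal I R" for I
  proof -
    obtain x where x: "x \<in> carrier R" "I = PIdl x" using ex_PIdl[OF I] by blast
    show ?thesis
    proof (cases "x \<in> PIdl (p [^] N)")
      case True
      then have "x = \<zero>" using pN unfolding cgenideal_def by auto
      then show ?thesis using x pN by auto
    next
      case False
      define P where "P k \<longleftrightarrow> x \<in> PIdl (p [^] k)" for k :: nat
      have "x = x \<otimes> p [^] (0::nat)" using x by simp
      then have P0: "P 0" using x unfolding P_def cgenideal_def by blast
      \<comment> \<open>The last power of p whose ideal contains \<open>x\<close>: the cofactor
        cannot lie in \<open>M\<close>, since otherwise one more factor p would split off, so it is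
        a unit.\<close>
      have "\<exists>k<N. P k \<and> \<not> P (Suc k)"
      proof (rule ccontr)
        assume "\<not> ?thesis"
        then have "k \<le> N \<Longrightarrow> P k" for k by (induction k) (use P0 in auto)
        then show False using False unfolding P_def by blast
      qed
      then obtain k where k: "k < N" "P k" "\<not> P (Suc k)" by blast
      then obtain b where b: "b \<in> carrier R" "x = b \<otimes> p [^] k" unfolding P_def cgenideal_def by blast
      have "b \<notin> M"
      proof
        assume "b \<in> M"
        then obtain c where c: "c \<in> carrier R" "b = c \<otimes> p" using p unfolding cgenideal_def by blast
        have "x = c \<otimes> p [^] Suc k" using b c p m_comm[of p "p [^] k"] by (simp add: m_assoc)
        then show False using k(3) c unfolding P_def cgenideal_def by blast
      qed
      then have "b \<in> Units R" using unit b by blast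
      then have "I = PIdl (p [^] k)" using PIdl_unit_mult x b p by simp
      then show ?thesis using k(1) by (intro exI[of _ k]) simp
    qed
  qed
  then show ?thesis using p(1) by (intro bexI[of _ p] exI[of _ N]) simp_all
qed

lemma finite_ideals: "finite (ideals R)"
proof -
  obtain p N where "\<forall>I. ideal I R \<longrightarrow> (\<exists>k\<le>N. I = PIdl (p [^] (k::nat)))" using ideals_eq_powers by blast
  then have "ideals R \<subseteq> (\<lambda>k. PIdl (p [^] k)) ` {..N}" by auto
  then show ?thesis by (rule finite_subset) simp
qed

lemma ideals_linear:
  assumes I: "ideal I R" and J: "ideal J R"
  shows "I \<subseteq> J \<or> J \<subseteq> I"
proof -
  obtain p N where p: "p \<in> carrier R" "\<forall>I. ideal I R \<longrightarrow> (\<exists>k\<le>N. I = PIdl (p [^] (k::nat)))"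
    using ideals_eq_powers by blast
  obtain i j :: nat where ij: "I = PIdl (p [^] i)" "J = PIdl (p [^] j)" using p(2) I J by meson
  have "PIdl (p [^] l) \<subseteq> PIdl (p [^] k)" if "k \<le> l" for k l :: nat
  proof (rule cgenideal_minimal)
    have "p [^] l = p [^] (l - k) \<otimes> p [^] k" using p(1) that by (simp add: nat_pow_mult)
    then show "p [^] l \<in> PIdl (p [^] k)" using p(1) unfolding cgenideal_def by blast
  qed (use p(1) in \<open>simp add: cgenideal_ideal\<close>)
  then show ?thesis using ij by (cases "i \<le> j") auto
qed

text \<open>The maximal ideal is proper and contains zero.\<close>

lemma carrier_ne_zero: "carrier R \<noteq> {\<zero>}"
proof
  assume *: "carrier R = {\<zero>}"
  obtain M where "maximalideal M R" using unique_maximalideal by blast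
  then have "ideal M R" "carrier R \<noteq> M" by (auto simp: maximalideal_def maximalideal_axioms_def)
  moreover have "\<zero> \<in> M" "M \<subseteq> carrier R"
    using \<open>ideal M R\<close> ideal_subset_carrier additive_subgroup.zero_closed ideal.axioms(1) by blast+
  ultimately show False using * by auto
qed

lemma ideals_eq_insert: "ideals R = insert {\<zero>} (insert (carrier R) (nontrivial_ideals R))"
  using zeroideal oneideal unfolding nontrivial_ideals_def by auto

lemma card_ideals: "card (ideals R) = card (nontrivial_ideals R) + 2"
proof -
  have "finite (nontrivial_ideals R)"
    using finite_ideals finite_subset unfolding nontrivial_ideals_def by (metis (no_types, lifting) Collect_mono)
  then show ?thesis
    using carrier_ne_zero unfolding ideals_eq_insert by (simp add: nontrivial_ideals_def)
qed

text \<open>A nonzero commutative ring with only the two trivial ideals is a field. This gives the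
  blocks of non-fields height at least 2.\<close>

lemma nontrivial_ideals_pos:
  assumes "\<not> field R"
  shows "0 < card (nontrivial_ideals R)"
proof (rule ccontr)
  assume "\<not> ?thesis"
  moreover have "finite (nontrivial_ideals R)"
    using finite_ideals finite_subset unfolding nontrivial_ideals_def by (metis (no_types, lifting) Collect_mono)
  ultimately have "nontrivial_ideals R = {}" by simp
  then have "ideals R = {{\<zero>}, carrier R}" using ideals_eq_insert by simp
  then show False using trivialideals_fieldI[OF carrier_ne_zero] assms by blast
qed

text \<open>The zero ideal and the whole ring add 2 to the count, and the height of a chain is one
  less than its number of elements.\<close>

lemma ideals_like_box: "ideals_like_box R [card (nontrivial_ideals R) + 1]"
  using ideals_linear card_ideals by (intro linear_ideals_like_box) auto

end

lemma field_ideals_like_box: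
  assumes "field F"
  shows "ideals_like_box F [1]"
proof -
  interpret field F by (rule assms)
  have "carrier F \<noteq> {\<zero>\<^bsub>F\<^esub>}" using one_not_zero one_closed by blast
  then have "card (ideals F) = Suc 1" unfolding all_ideals by auto
  moreover have "I \<subseteq> J \<or> J \<subseteq> I" if "ideal I F" "ideal J F" for I J
  proof -
    have "I \<in> {{\<zero>\<^bsub>F\<^esub>}, carrier F}" "J \<in> {{\<zero>\<^bsub>F\<^esub>}, carrier F}" using that all_ideals by auto
    then show ?thesis by auto
  qed
  ultimately show ?thesis by (intro linear_ideals_like_box)
qed

section \<open>The strong metric dimension\<close>

context chain_product
begin

text \<open>The first 2 subtracted accounts for the zero ideal and the whole ring. The second claim
  makes the truncated subtractions exact.\<close>

lemma sdim_ideals_like_box: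
  assumes R: "ring R" and box: "ideals_like_box R hs"
  shows "sdim (with_proj (inclusion_ideal_graph R)) =
    prod_list (map Suc hs) - 2 - (sum_list hs - 1 + card singles)"
    and "2 + (sum_list hs - 1 + card singles) \<le> prod_list (map Suc hs)"
proof -
  interpret ring R by (rule R)
  obtain f where f: "bij_betw f (ideals R) {xs. list_all2 (\<le>) xs hs}"
    "\<And>I J. ideal I R \<Longrightarrow> ideal J R \<Longrightarrow> I \<subseteq> J \<longleftrightarrow> list_all2 (\<le>) (f I) (f J)"
    using box unfolding ideals_like_box_def by auto
  define \<phi> where "\<phi> = cells \<circ> f"
  have bij: "bij_betw \<phi> (ideals R) (downsets hs)"
    unfolding \<phi>_def by (rule bij_betw_trans[OF f(1) bij_betw_cells])
  have len: "length (f I) = length hs" if "ideal I R" for I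
    using bij_betwE[OF f(1)] that list_all2_lengthD by blast
  have le: "I \<subseteq> J \<longleftrightarrow> \<phi> I \<subseteq> \<phi> J" if "ideal I R" "ideal J R" for I J
    using f(2)[OF that] len that cells_subset_iff[of "f I" "f J"] unfolding \<phi>_def by simp
  have down: "{} \<in> downsets hs" "E \<in> downsets hs"
    unfolding downsets_def by auto
  have surj: "\<exists>I. ideal I R \<and> \<phi> I = D" if "D \<in> downsets hs" for D
    using bij that unfolding bij_betw_def by (metis (no_types, lifting) imageE mem_Collect_eq)
  have sub: "\<phi> I \<subseteq> E" if "ideal I R" for I
    using bij_betwE[OF bij] that unfolding downsets_def by blast
  \<comment> \<open>The least and the greatest ideal must correspond to the least and the greatest
    downset.\<close>
  have zero: "\<phi> {\<zero>\<^bsub>R\<^esub>} = {}"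
  proof -
    obtain I where I: "ideal I R" "\<phi> I = {}" using surj down by blast
    have "{\<zero>\<^bsub>R\<^esub>} \<subseteq> I" using I(1) by (simp add: additive_subgroup.zero_closed ideal.axioms(1))
    then show ?thesis using le[OF zeroideal I(1)] I(2) by simp
  qed
  have carr: "\<phi> (carrier R) = E"
  proof -
    obtain I where I: "ideal I R" "\<phi> I = E" using surj down by blast
    have "I \<subseteq> carrier R" using I(1) by (simp add: additive_subgroup.a_subset ideal.axioms(1))
    then show ?thesis using le[OF I(1) oneideal] I(2) sub[OF oneideal] by simp
  qed
  have "nontrivial_ideals R = ideals R - {{\<zero>\<^bsub>R\<^esub>}, carrier R}"
    unfolding nontrivial_ideals_def by auto
  moreover have "bij_betw \<phi> (ideals R - {{\<zero>\<^bsub>R\<^esub>}, carrier R}) (downsets hs - {{}, E})"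
    using zeroideal oneideal zero carr down
      bij_betw_DiffI[OF bij, of "{{\<zero>\<^bsub>R\<^esub>}, carrier R}" "{{}, E}"]
      bij_betw_subset[OF bij, of "{{\<zero>\<^bsub>R\<^esub>}, carrier R}" "{{}, E}"] by simp
  ultimately have V: "bij_betw \<phi> (pverts (inclusion_ideal_graph R)) V"
    unfolding inclusion_ideal_graph_def V_def by simp
  have lt: "I \<subset> J \<longleftrightarrow> \<phi> I \<subset> \<phi> J" if "ideal I R" "ideal J R" for I J
    using le[OF that] le[OF that(2,1)] by (simp add: less_le_not_le)
  have arcs: "(I, J) \<in> parcs (inclusion_ideal_graph R) \<longleftrightarrow> I \<in> pverts (inclusion_ideal_graph R) \<and>
      J \<in> pverts (inclusion_ideal_graph R) \<and> adj (\<phi> I) (\<phi> J)" for I J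
    using lt[of I J] lt[of J I] unfolding inclusion_ideal_graph_def adj_def nontrivial_ideals_def by auto
  have "card (downsets hs) = prod_list (map Suc hs)"
    using bij_betw_same_card[OF bij_betw_cells] list_all2_le_finite_card by metis
  moreover have "E \<noteq> {}" using three_le_card_E by auto
  ultimately have "card V = prod_list (map Suc hs) - 2"
    using down unfolding V_def by (simp add: card_Diff_subset)
  then show "sdim (with_proj (inclusion_ideal_graph R)) =
      prod_list (map Suc hs) - 2 - (sum_list hs - 1 + card singles)"
    and "2 + (sum_list hs - 1 + card singles) \<le> prod_list (map Suc hs)"
    using sdim_eq[OF V arcs] card_family_bound_le_card_V three_le_card_E
    by (simp_all add: card_cells)
qed

end

theorem theorem3p4:
  fixes R :: "('r, 'x) ring_scheme"
    and Rs :: "('a, 'y) ring_scheme list"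
    and Fs :: "('b, 'z) ring_scheme list"
    and m n :: nat
    and \<nu> :: "nat \<Rightarrow> nat"
  assumes "m \<ge> 1" and "n \<ge> 1"
    and "length Rs = m" and "length Fs = n"
    and "cring R"
    and "R \<simeq> RDirProd (RDirProd_list Rs) (RDirProd_list Fs)"
    and "\<And>i. i < m \<Longrightarrow> local_artinian_principal_ring (Rs ! i)"
    and "\<And>i. i < m \<Longrightarrow> \<not> field (Rs ! i)"
    and "\<And>j. j < n \<Longrightarrow> field (Fs ! j)"
    and "\<And>i. i < m \<Longrightarrow> \<nu> i = card (nontrivial_ideals (Rs ! i))"
  shows "(m = 1 \<longrightarrow>
           int (sdim (with_proj (inclusion_ideal_graph R))) =
             (int (\<nu> 0) + 2) * 2 ^ n - 2 * int n - int (\<nu> 0) - 2) \<and>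
         (m \<ge> 2 \<longrightarrow>
           int (sdim (with_proj (inclusion_ideal_graph R))) =
             (\<Prod>i<m. (int (\<nu> i) + 2)) * 2 ^ n - (\<Sum>i<m. int (\<nu> i)) - 2 * int n - int m - 1)"
proof -
  have \<nu>: "0 < \<nu> i" if "i < m" for i
    using local_artinian_principal_ring.nontrivial_ideals_pos[OF assms(7)] assms(8,10) that by simp
  have ringR: "ring R" using \<open>cring R\<close> by (rule cring.axioms(1))
  have ringRs: "ring (Rs ! i)" if "i < m" for i
    using assms(7)[OF that]
    by (simp add: local_artinian_principal_ring_def local_cring_def cring.axioms(1))
  have ringFs: "ring (Fs ! j)" if "j < n" for j
    using assms(9)[OF that] by (simp add: field_def domain_def cring.axioms(1))
  \<comment> \<open>The non-fields come first in \<open>hR @ hF\<close>, so that block 0 has height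
    \<nu> 0 + 1 \<ge> 2.\<close>
  define hR where "hR = map (\<lambda>i. \<nu> i + 1) [0..<m]"
  define hF where "hF = replicate n (1::nat)"
  have len: "length hR = m" "length hF = n" unfolding hR_def hF_def by simp_all
  have "ideals_like_box (RDirProd_list Rs) hR"
    using assms(3,10) local_artinian_principal_ring.ideals_like_box[OF assms(7)] ringRs
    by (intro ideals_like_box_RDirProd_list) (simp add: list_all2_conv_all_nth hR_def)
  moreover have "ideals_like_box (RDirProd_list Fs) hF"
    using assms(4) field_ideals_like_box[OF assms(9)] ringFs
    by (intro ideals_like_box_RDirProd_list) (simp add: list_all2_conv_all_nth hF_def)
  moreover have rings: "ring (RDirProd_list Rs)" "ring (RDirProd_list Fs)"
    using ringRs ringFs assms(3,4) by (auto intro: RDirProd_list_is_ring)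
  ultimately have box: "ideals_like_box R (hR @ hF)"
    using ideals_like_box_iso[OF ringR RDirProd_ring[OF rings] assms(6)] ideals_like_box_RDirProd by blast
  interpret chain_product "hR @ hF"
  proof
    show "2 \<le> length (hR @ hF)" using len assms(1,2) by simp
    show "0 < (hR @ hF) ! i" if "i < length (hR @ hF)" for i
      using that by (auto simp: nth_append hR_def hF_def)
    show "2 \<le> (hR @ hF) ! 0"
      using \<nu>[of 0] assms(1) by (auto simp: nth_append hR_def)
  qed
  \<comment> \<open>Since \<nu> i > 0 for i < m, exactly the field blocks have height 1.\<close>
  have "(hR @ hF) ! i = 1 \<longleftrightarrow> m \<le> i" if "i < m + n" for i
    using that \<nu>[of i] by (cases "i < m") (simp_all add: nth_append hR_def hF_def)
  then have "singles = {m..<m + n}" unfolding singles_def by (auto simp: len)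
  then have singles: "card singles = n" by simp
  have prod: "int (prod_list (map Suc (hR @ hF))) = (\<Prod>i<m. (int (\<nu> i) + 2)) * 2 ^ n"
  proof -
    have "prod_list (map Suc hR) = (\<Prod>i<m. \<nu> i + 2)"
      using prod.distinct_set_conv_list[of "[0..<m]" "\<lambda>i. \<nu> i + 2"]
      unfolding hR_def by (simp add: comp_def lessThan_atLeast0)
    moreover have "prod_list (map Suc hF) = 2 ^ n" unfolding hF_def by (simp add: numeral_2_eq_2)
    ultimately show ?thesis by (simp add: of_nat_prod add.commute)
  qed
  have sum: "sum_list (hR @ hF) = (\<Sum>i<m. \<nu> i) + m + n"
  proof -
    have "sum_list hR = (\<Sum>i<m. \<nu> i + 1)"
      unfolding hR_def by (simp add: sum_list_distinct_conv_sum_set lessThan_atLeast0)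
    then show ?thesis unfolding hF_def by (simp add: sum.distrib sum_list_replicate sum_Suc)
  qed
  \<comment> \<open>Let s be the sum of the \<nu> i. There are s + m + n cells, so 2 + (s + m + n -
    1) + n = s + m + 2n + 1 is subtracted. The formula holds for every m \<ge> 1 and contains both
    claims; for m = 1, m + 1 becomes 2.\<close>
  have "int (sdim (with_proj (inclusion_ideal_graph R))) =
      (\<Prod>i<m. (int (\<nu> i) + 2)) * 2 ^ n - (\<Sum>i<m. int (\<nu> i)) - 2 * int n - int m - 1"
    using sdim_ideals_like_box[OF ringR box] assms(1) unfolding prod[symmetric] sum singles
    by (simp add: of_nat_diff)
  then show ?thesis by (auto simp: lessThan_Suc)
qed

end
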